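(* Let $\alpha=[a_0;a_1,a_2,\dots]$ be irrational with convergent denominators $q_k$, and assume $\frac{\log a_k}{a_{k+1}} \le T$ for all $k \ge k_0$ with some constants $k_0,T\ge 1$. Let $N^*=\sum_{k=0}^{K-1} \lfloor (5/6)a_{k+1}\rfloor q_k$. Then \[ \log P_{N^*} (\alpha ) = \frac{\mathrm{Vol}(4_1)}{4 \pi} \sum_{k=1}^{K} a_k + \frac{1}{2} \sum_{k=1}^{K} \log a_k + O_T \left( \sum_{k=1}^{K} \frac{1 +\log (a_k a_{k+1})}{a_{k+1}} \right) +O_{\alpha} (1) . \]
   Context: $P_N(\alpha)=\prod_{n=1}^N |2\sin(\pi n\alpha)|$. $\mathrm{Vol}(4_1)=4\pi\int_0^{5/6}\log(2\sin(\pi x))\,\mathrm{d}x\approx 2.02988$ (the hyperbolic volume of the figure-eight knot complement). The $q_k$ are the denominators of the convergents $[a_0;a_1,\dots,a_k]$, $q_0=1$, $q_1=a_1$, $q_{k+1}=a_{k+1}q_k+q_{k-1}$. $O_T$: implied constant depending only on $T$; $O_\alpha$: implied constant that may depend on $\alpha$ (including $k_0,T$) but not on $K$. *)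

theory Defs
  imports "HOL-Analysis.Analysis"
begin

fun cf_rest :: "real \<Rightarrow> nat \<Rightarrow> real" where
  "cf_rest x 0 = x"
| "cf_rest x (Suc k) = 1 / frac (cf_rest x k)"

definition cf_a :: "real \<Rightarrow> nat \<Rightarrow> int" where
  "cf_a x k = \<lfloor>cf_rest x k\<rfloor>"

fun cf_q :: "real \<Rightarrow> nat \<Rightarrow> int" where
  "cf_q x 0 = 1"
| "cf_q x (Suc 0) = cf_a x 1"
| "cf_q x (Suc (Suc k)) = cf_a x (k + 2) * cf_q x (Suc k) + cf_q x k"

definition sinprod :: "nat \<Rightarrow> real \<Rightarrow> real" where
  "sinprod N x = (\<Prod>n=1..N. \<bar>2 * sin (pi * real n * x)\<bar>)"

text \<open>Hyperbolic volume of the figure-eight knot complement,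
  Vol(4_1) = 4 pi int_0^{5/6} log(2 sin(pi x)) dx.\<close>
definition vol41 :: real where
  "vol41 = 4 * pi * integral {0..5/6} (\<lambda>x. ln (2 * sin (pi * x)))"

definition Nstar :: "real \<Rightarrow> nat \<Rightarrow> nat" where
  "Nstar x K = nat (\<Sum>k<K. \<lfloor>(5/6) * real_of_int (cf_a x (k+1))\<rfloor> * cf_q x k)"

end

theory Submission
  imports Defs "HOL-Real_Asymp.Real_Asymp"
begin

text \<open>
  Write \<open>f(x) = ln (2 sin (pi x))\<close> and let \<open>\<alpha>\<close> be irrational in \<open>(0, 1)\<close>. For lattice points with
  \<open>-\<alpha> < N\<alpha> - M < 1\<close>, the difference of the log Sudler products \<open>ln P_N(\<alpha>) - ln P_M(1/\<alpha>)\<close> depends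
  only on \<open>\<theta> = N\<alpha> - M\<close>: it is the limit of explicit sums of ln Gamma terms, because these satisfy in
  the limit the two functional equations \<open>F(\<theta>) - F(\<theta> - \<alpha>) = f(\<theta>)\<close> and
  \<open>F(\<theta>) - F(\<theta> - 1) = f((1 - \<theta>)/\<alpha>)\<close>. The sums are concave on the right half of the strip, so as
  in the Bohr-Mollerup theorem the first equation pins \<open>F(\<theta>)\<close> near \<open>5/6\<close> (the zero of \<open>f\<close>) up to
  \<open>O(\<alpha>)\<close> to a value \<open>F(n\<alpha>) = ln P_n(\<alpha>)\<close> with \<open>n\<alpha> < 1\<close>, which Stirling's formula evaluates as
  \<open>Vol(4_1)/(4 pi \<alpha>) + ln (1/\<alpha>)/2 + O(\<alpha>)\<close>. Since \<open>N*\<close> for \<open>\<alpha>\<close> and \<open>N*\<close> for the next point of the Gauss map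
  are such a pair with \<open>\<theta> = 5/6 + O(\<alpha>)\<close>, summing over the Gauss orbit gives the expansion with
  error \<open>O(\<Sum> 1/a_k)\<close>.
\<close>

section \<open>Stirling's formula for the Gamma function\<close>

lemma ln_Gamma_plus1_real:
  assumes "(x::real) > 0"
  shows "ln_Gamma (x + 1) = ln x + ln_Gamma x"
proof -
  have "x \<notin> \<int>\<^sub>\<le>\<^sub>0" using assms by (auto elim!: nonpos_Ints_cases)
  then have "Gamma (x + 1) = x * Gamma x" by (rule Gamma_plus1)
  then show ?thesis
    using assms Gamma_real_pos[of x] by (simp add: ln_Gamma_real_pos ln_mult_pos del: Gamma_real_pos)
qed

lemma ln_Gamma_reflection_real:
  assumes "0 < v" "v < (1::real)"
  shows "ln_Gamma v + ln_Gamma (1 - v) = ln (2 * pi) - ln (2 * sin (pi * v))"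
proof -
  have s: "sin (pi * v) > 0" using assms by (intro sin_gt_zero) auto
  have e: "1 - complex_of_real v = of_real (1 - v)"
    "sin (complex_of_real pi * of_real v) = of_real (sin (pi * v))"
    by (simp_all add: sin_of_real[symmetric])
  have "complex_of_real (Gamma v) * of_real (Gamma (1 - v)) = of_real pi / of_real (sin (pi * v))"
    using Gamma_reflection_complex[of "of_real v"] unfolding e Gamma_complex_of_real .
  then have "complex_of_real (Gamma v * Gamma (1 - v)) = of_real (pi / sin (pi * v))"
    unfolding of_real_mult of_real_divide .
  then have "Gamma v * Gamma (1 - v) = pi / sin (pi * v)"
    using of_real_eq_iff by blast
  then have "ln (Gamma v * Gamma (1 - v)) = ln (pi / sin (pi * v))" by (rule arg_cong)
  then show ?thesis
    using assms s Gamma_real_pos[of v] Gamma_real_pos[of "1 - v"]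
    by (simp add: ln_Gamma_real_pos ln_mult_pos ln_div del: Gamma_real_pos)
qed

text \<open>Stirling's approximation stripped of its constant. The limit at infinity, ln (2 pi) / 2,
  is determined below.\<close>

definition stirling_defect :: "real \<Rightarrow> real" where
  "stirling_defect x = ln_Gamma x - (x - 1/2) * ln x + x"

text \<open>The difference is (x + 1/2) times the integral of 1/t over [x, x + 1], minus 1. Since
  1/t is convex, the midpoint rule bounds the integral from below and the trapezoid rule from above.
  The upper bound is put in a form that telescopes.\<close>

lemma stirling_defect_step:
  assumes "x > 0"
  shows "0 \<le> stirling_defect x - stirling_defect (x + 1)"
    and "stirling_defect x - stirling_defect (x + 1) \<le> 1 / (4 * x) - 1 / (4 * (x + 1))"
proof -
  have eq: "stirling_defect x - stirling_defect (x + 1) = (x + 1/2) * (ln (x + 1) - ln x) - 1"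
    using ln_Gamma_plus1_real[OF assms] by (simp add: stirling_defect_def algebra_simps)
  have "2 / (2 * x + 1) \<le> ln (x + 1) - ln x"
    using ln_inverse_approx_ge[of x "x + 1"] assms by (simp add: add_ac)
  then have "(x + 1/2) * (2 / (2 * x + 1)) \<le> (x + 1/2) * (ln (x + 1) - ln x)"
    using assms by (intro mult_left_mono) auto
  moreover have "(x + 1/2) * (2 / (2 * x + 1)) = 1" using assms by (simp add: field_simps)
  ultimately show "0 \<le> stirling_defect x - stirling_defect (x + 1)" using eq by linarith
  have "ln (x + 1) - ln x \<le> (inverse x + inverse (x + 1)) / 2"
    using ln_inverse_approx_le[of x 1] assms by simp
  then have "(x + 1/2) * (ln (x + 1) - ln x) \<le> (x + 1/2) * ((inverse x + inverse (x + 1)) / 2)"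
    using assms by (intro mult_left_mono) auto
  moreover have "(x + 1/2) * ((inverse x + inverse (x + 1)) / 2) - 1 = 1 / (4 * x) - 1 / (4 * (x + 1))"
    using assms by (simp add: divide_simps) (simp add: algebra_simps)
  ultimately show "stirling_defect x - stirling_defect (x + 1) \<le> 1 / (4 * x) - 1 / (4 * (x + 1))"
    using eq by linarith
qed

lemma stirling_defect_diff:
  assumes "x > 0"
  shows "0 \<le> stirling_defect x - stirling_defect (x + real n)"
    and "stirling_defect x - stirling_defect (x + real n) \<le> 1 / (4 * x) - 1 / (4 * (x + real n))"
proof (induction n)
  case (Suc n)
  have "x + real n > 0" using assms by simp
  note st = stirling_defect_step[OF this]
  { case 1 show ?case using Suc st by (simp add: add_ac) }
  { case 2 show ?case using Suc st by (simp add: add_ac) }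
qed simp_all

lemma ln_Gamma_plus_of_nat:
  assumes "(x::real) > 0"
  shows "ln_Gamma (x + real n) = ln_Gamma x + (\<Sum>k<n. ln (x + real k))"
proof (induction n)
  case (Suc n)
  have "ln_Gamma (x + real (Suc n)) = ln (x + real n) + ln_Gamma (x + real n)"
    using ln_Gamma_plus1_real[of "x + real n"] assms by (simp add: add_ac)
  then show ?case using Suc by simp
qed simp

text \<open>The limit formula \<open>ln_Gamma_series\<close> for ln Gamma amounts to the quotient
  Gamma(x + 1 + n) / Gamma(1 + n) compared with n to the power x. It therefore forces the Stirling
  constant to be the same along every shifted sequence.\<close>

lemma stirling_defect_shift_LIMSEQ:
  assumes "x > 0"
  shows "(\<lambda>n. stirling_defect (x + 1 + real n) - stirling_defect (1 + real n)) \<longlonglongrightarrow> 0"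
proof -
  have "(\<lambda>n. ln_Gamma x - ln_Gamma_series x n) \<longlonglongrightarrow> 0"
    using tendsto_diff[OF tendsto_const[of "ln_Gamma x"] ln_Gamma_real_LIMSEQ[OF assms]] by simp
  moreover have "ln_Gamma x - ln_Gamma_series x n
      = ln_Gamma (x + 1 + real n) - ln_Gamma (1 + real n) - x * ln (real n)" if "n > 0" for n
  proof -
    have "(\<Sum>k=1..n. ln (x / real k + 1)) = (\<Sum>k=1..n. ln (x + real k) - ln (real k))"
    proof (intro sum.cong refl)
      fix k assume "k \<in> {1..n}"
      then have "real k > 0" by simp
      then have "x / real k + 1 = (x + real k) / real k" by (simp add: field_simps)
      then show "ln (x / real k + 1) = ln (x + real k) - ln (real k)"
        using assms \<open>real k > 0\<close> by (simp add: ln_div)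
    qed
    also have "\<dots> = (\<Sum>k<n. ln (x + 1 + real k) - ln (1 + real k))"
      by (rule sum.reindex_bij_witness[of _ Suc "\<lambda>k. k - 1"]) (auto simp: add_ac of_nat_diff)
    also have "\<dots> = (ln_Gamma (x + 1 + real n) - ln_Gamma (x + 1)) - (ln_Gamma (1 + real n) - ln_Gamma 1)"
      using ln_Gamma_plus_of_nat[of "x + 1" n] ln_Gamma_plus_of_nat[of 1 n] assms
      by (simp add: sum_subtractf)
    finally show ?thesis
      using ln_Gamma_plus1_real[OF assms]
      by (simp add: ln_Gamma_series_def ln_Gamma_real_pos)
  qed
  then have "eventually (\<lambda>n. ln_Gamma x - ln_Gamma_series x n
      = ln_Gamma (x + 1 + real n) - ln_Gamma (1 + real n) - x * ln (real n)) sequentially"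
    by (auto intro!: eventually_mono[OF eventually_gt_at_top[of 0]])
  ultimately have *: "(\<lambda>n. ln_Gamma (x + 1 + real n) - ln_Gamma (1 + real n) - x * ln (real n)) \<longlonglongrightarrow> 0"
    by (rule Lim_transform_eventually)
  have "(\<lambda>n. x * ln (real n) - (x + 1/2 + real n) * ln (x + 1 + real n) + x
          + (1/2 + real n) * ln (1 + real n)) \<longlonglongrightarrow> 0"
    using assms by real_asymp
  from tendsto_add[OF * this] show ?thesis
    by (simp add: stirling_defect_def algebra_simps)
qed

lemma ln_Gamma_duplication_real:
  assumes "(x::real) > 0"
  shows "ln_Gamma x + ln_Gamma (x + 1/2) = (1 - 2 * x) * ln 2 + ln pi / 2 + ln_Gamma (2 * x)"
proof -
  have a: "of_real x \<notin> (\<int>\<^sub>\<le>\<^sub>0::complex set)" "of_real x + 1/2 \<notin> (\<int>\<^sub>\<le>\<^sub>0::complex set)"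
    using assms by (auto elim!: nonpos_Ints_cases simp: complex_eq_iff)
  have e: "complex_of_real x + 1/2 = of_real (x + 1/2)" "2 * complex_of_real x = of_real (2 * x)"
    "exp ((1 - of_real (2 * x)) * of_real (ln 2)) = complex_of_real (exp ((1 - 2 * x) * ln 2))"
    by (simp_all add: exp_of_real[symmetric])
  have "complex_of_real (Gamma x) * of_real (Gamma (x + 1/2))
      = of_real (exp ((1 - 2 * x) * ln 2)) * of_real (sqrt pi) * of_real (Gamma (2 * x))"
    using Gamma_legendre_duplication[OF a] unfolding e Gamma_complex_of_real .
  then have "complex_of_real (Gamma x * Gamma (x + 1/2))
      = of_real (exp ((1 - 2 * x) * ln 2) * sqrt pi * Gamma (2 * x))"
    unfolding of_real_mult .
  then have "Gamma x * Gamma (x + 1/2) = exp ((1 - 2 * x) * ln 2) * sqrt pi * Gamma (2 * x)"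
    using of_real_eq_iff by blast
  then have "ln (Gamma x * Gamma (x + 1/2)) = ln (exp ((1 - 2 * x) * ln 2) * sqrt pi * Gamma (2 * x))"
    by simp
  then show ?thesis
    using assms Gamma_real_pos[of x] Gamma_real_pos[of "x + 1/2"] Gamma_real_pos[of "2 * x"]
    by (simp add: ln_Gamma_real_pos ln_mult_pos ln_sqrt del: Gamma_real_pos)
qed

text \<open>The defects decrease along 1 + n and are bounded below, so they converge to a constant
  c, which the shift lemma makes independent of x. The duplication formula at 1 + n then yields c +
  c - c on one side and an elementary limit on the other, which identifies c.\<close>

lemma stirling_defect_LIMSEQ:
  assumes "x > 0"
  shows "(\<lambda>n. stirling_defect (x + real n)) \<longlonglongrightarrow> ln (2 * pi) / 2"
proof -
  let ?s = "\<lambda>n. stirling_defect (1 + real n)"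
  have "decseq ?s"
    using stirling_defect_step(1)[of "1 + real n" for n] by (intro decseq_SucI) (simp add: add_ac)
  moreover have "?s 0 - 1/4 \<le> ?s n" for n
  proof -
    have "1 / (4 * (1 + real n)) \<ge> 0" by simp
    then show ?thesis
      using stirling_defect_diff(2)[OF zero_less_one, of n] unfolding of_nat_0 add_0_right mult_1_right
      by linarith
  qed
  ultimately obtain c where c: "?s \<longlonglongrightarrow> c"
    by (metis decseq_convergent)
  have lim1: "(\<lambda>n. stirling_defect (y + 1 + real n)) \<longlonglongrightarrow> c" if "y > 0" for y
    using tendsto_add[OF stirling_defect_shift_LIMSEQ[OF that] c] by simp
  have lim2: "(\<lambda>n. stirling_defect (y + real n)) \<longlonglongrightarrow> c" if "y > 0" for y
  proof -
    have "(\<lambda>n. stirling_defect (y + real (Suc n))) \<longlonglongrightarrow> c"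
      using lim1[OF that] by (simp add: add_ac)
    then show ?thesis by (rule LIMSEQ_imp_Suc)
  qed
  \<comment> \<open>The doubled argument 2 (1 + n) equals 1 + (2 n + 1), so it runs through a
    subsequence of the shifts of 1.\<close>
  have "(\<lambda>n. stirling_defect (1 + real (2 * n + 1))) \<longlonglongrightarrow> c"
    by (rule filterlim_compose[OF c, of "\<lambda>n. 2 * n + 1"])  (rule filterlim_subseq, simp add: strict_mono_def)
  then have "(\<lambda>n. ?s n + stirling_defect (3/2 + real n) - stirling_defect (2 + 2 * real n)) \<longlonglongrightarrow> c + c - c"
    using lim2[of "3/2"] c by (intro tendsto_intros) (auto simp: add_ac)
  moreover have "?s n + stirling_defect (3/2 + real n) - stirling_defect (2 + 2 * real n)
     = (1 - 2 * (1 + real n)) * ln 2 + ln pi / 2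
       - (1/2 + real n) * ln (1 + real n) - (1 + real n) * ln (3/2 + real n) + 1/2
       + (3/2 + 2 * real n) * ln (2 + 2 * real n)" for n
    using ln_Gamma_duplication_real[of "1 + real n"]
    by (simp add: stirling_defect_def algebra_simps)
  ultimately have "(\<lambda>n. (1 - 2 * (1 + real n)) * ln 2 + ln pi / 2
       - (1/2 + real n) * ln (1 + real n) - (1 + real n) * ln (3/2 + real n) + 1/2
       + (3/2 + 2 * real n) * ln (2 + 2 * real n)) \<longlonglongrightarrow> c" by simp
  moreover have "(\<lambda>n. (1 - 2 * (1 + real n)) * ln 2 + ln pi / 2
       - (1/2 + real n) * ln (1 + real n) - (1 + real n) * ln (3/2 + real n) + 1/2
       + (3/2 + 2 * real n) * ln (2 + 2 * real n)) \<longlonglongrightarrow> ln 2 / 2 + ln pi / 2"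
    by real_asymp
  ultimately have "c = ln 2 / 2 + ln pi / 2" by (rule LIMSEQ_unique)
  then show ?thesis using lim2[OF assms] by (simp add: ln_mult add_divide_distrib)
qed

lemma stirling_defect_bounds:
  assumes "x > 0"
  shows "ln (2 * pi) / 2 \<le> stirling_defect x"
    and "stirling_defect x \<le> ln (2 * pi) / 2 + 1 / (4 * x)"
proof -
  note l = stirling_defect_LIMSEQ[OF assms]
  show "ln (2 * pi) / 2 \<le> stirling_defect x"
    by (rule LIMSEQ_le_const2[OF l]) (use stirling_defect_diff(1)[OF assms] in auto)
  have "stirling_defect x - 1 / (4 * x) \<le> stirling_defect (x + real n)" for n
  proof -
    have "1 / (4 * (x + real n)) \<ge> 0" using assms by simp
    then show ?thesis using stirling_defect_diff(2)[OF assms, of n] by linarith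
  qed
  then have "stirling_defect x - 1 / (4 * x) \<le> ln (2 * pi) / 2"
    by (intro LIMSEQ_le_const[OF l]) auto
  then show "stirling_defect x \<le> ln (2 * pi) / 2 + 1 / (4 * x)" by simp
qed

lemma stirling_defect_at_top: "(stirling_defect \<longlongrightarrow> ln (2 * pi) / 2) at_top"
proof (rule tendsto_sandwich[of "\<lambda>_. ln (2 * pi) / 2" _ _ "\<lambda>x. ln (2 * pi) / 2 + 1 / (4 * x)"])
  show "((\<lambda>x. ln (2 * pi) / 2 + 1 / (4 * x)) \<longlongrightarrow> ln (2 * pi) / 2) at_top" by real_asymp
qed (use stirling_defect_bounds in \<open>auto intro!: eventually_mono[OF eventually_gt_at_top[of 0]] simp del: divide_le_eq_numeral1 le_divide_eq_numeral1\<close>)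

text \<open>The dependence on v vanishes in the limit because the exponents X + v - 1/2 and X + 1/2
  - v add up to 2 X. This pair is the boundary term left over in both functional equations of the
  kernel.\<close>

lemma ln_Gamma_pair_at_top:
  "((\<lambda>X. ln_Gamma (X + v) + ln_Gamma (X + 1 - v) - (2 * X * ln X - 2 * X + ln (2 * pi))) \<longlongrightarrow> 0) at_top"
proof -
  have "((\<lambda>X. stirling_defect (X + v)) \<longlongrightarrow> ln (2 * pi) / 2) at_top"
    by (rule filterlim_compose[OF stirling_defect_at_top]) real_asymp
  moreover have "((\<lambda>X. stirling_defect (X + 1 - v)) \<longlongrightarrow> ln (2 * pi) / 2) at_top"
    by (rule filterlim_compose[OF stirling_defect_at_top]) real_asymp
  moreover have "((\<lambda>X. (X + v - 1/2) * ln (X + v) - (X + v) + (X + 1 - v - 1/2) * ln (X + 1 - v)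
      - (X + 1 - v) - (2 * X * ln X - 2 * X)) \<longlongrightarrow> 0) at_top"
    by real_asymp
  ultimately have "((\<lambda>X. stirling_defect (X + v) + stirling_defect (X + 1 - v)
     + ((X + v - 1/2) * ln (X + v) - (X + v) + (X + 1 - v - 1/2) * ln (X + 1 - v)
      - (X + 1 - v) - (2 * X * ln X - 2 * X)) - ln (2 * pi))
     \<longlongrightarrow> ln (2 * pi) / 2 + ln (2 * pi) / 2 + 0 - ln (2 * pi)) at_top"
    by (intro tendsto_intros)
  then show ?thesis
    by (simp add: stirling_defect_def algebra_simps)
qed

section \<open>Renormalization of Sudler products\<close>

text \<open>A truncation of the logarithm, up to sign convention, of the double sine function with
  periods 1 and \<alpha>, normalized to vanish at \<theta> = 0. The last term, linear in \<theta>,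
  compensates the growth of the sum; the same coefficient serves the shift by \<alpha> and the shift
  by 1.\<close>

definition log_kernel :: "real \<Rightarrow> nat \<Rightarrow> real \<Rightarrow> real" where
  "log_kernel \<alpha> L \<theta> =
     (\<Sum>j<L. ln_Gamma (1 + (\<theta> + real j) / \<alpha>) - ln_Gamma ((real j + 1 - \<theta>) / \<alpha>)
          - (ln_Gamma (1 + real j / \<alpha>) - ln_Gamma ((real j + 1) / \<alpha>)))
     - (2 * (real L / \<alpha>) * ln (real L / \<alpha>) - 2 * (real L / \<alpha>)) * \<theta>"

lemma log_kernel_0 [simp]: "log_kernel \<alpha> L 0 = 0"
  by (simp add: log_kernel_def)

lemma log_kernel_diff:
  "log_kernel \<alpha> L s - log_kernel \<alpha> L t =
     (\<Sum>j<L. (ln_Gamma (1 + (s + real j) / \<alpha>) - ln_Gamma (1 + (t + real j) / \<alpha>))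
          + (ln_Gamma ((real j + 1 - t) / \<alpha>) - ln_Gamma ((real j + 1 - s) / \<alpha>)))
     - (2 * (real L / \<alpha>) * ln (real L / \<alpha>) - 2 * (real L / \<alpha>)) * (s - t)"
proof -
  define A where "A = 2 * (real L / \<alpha>) * ln (real L / \<alpha>) - 2 * (real L / \<alpha>)"
  show ?thesis
    unfolding log_kernel_def A_def[symmetric] by (simp add: sum_subtractf sum.distrib algebra_simps)
qed

text \<open>Shifting \<theta> by \<alpha> moves every Gamma argument by 1, so each summand collapses
  to a logarithm. Summed over j, these logarithms rebuild ln Gamma at \<theta> + L and 1 - \<theta>
  + L, which the linear term cancels in the limit, and at \<theta> and 1 - \<theta>, where the
  reflection formula produces the sine.\<close>

lemma log_kernel_shift_LIMSEQ:
  assumes \<alpha>: "\<alpha> > 0" and \<theta>: "0 < \<theta>" "\<theta> < 1"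
  shows "(\<lambda>L. log_kernel \<alpha> L \<theta> - log_kernel \<alpha> L (\<theta> - \<alpha>)) \<longlonglongrightarrow> ln (2 * sin (pi * \<theta>))"
proof -
  have eq: "log_kernel \<alpha> L \<theta> - log_kernel \<alpha> L (\<theta> - \<alpha>)
     = ln_Gamma (real L + \<theta>) + ln_Gamma (real L + 1 - \<theta>)
       - (2 * real L * ln (real L) - 2 * real L + ln (2 * pi)) + ln (2 * sin (pi * \<theta>))"
    if "L > 0" for L
  proof -
    have "log_kernel \<alpha> L \<theta> - log_kernel \<alpha> L (\<theta> - \<alpha>)
      = (\<Sum>j<L. (ln_Gamma (1 + (\<theta> + real j) / \<alpha>) - ln_Gamma (1 + (\<theta> - \<alpha> + real j) / \<alpha>))
             + (ln_Gamma ((real j + 1 - (\<theta> - \<alpha>)) / \<alpha>) - ln_Gamma ((real j + 1 - \<theta>) / \<alpha>)))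
        - (2 * (real L / \<alpha>) * ln (real L / \<alpha>) - 2 * (real L / \<alpha>)) * \<alpha>"
      by (simp add: log_kernel_diff)
    also have "(\<Sum>j<L. (ln_Gamma (1 + (\<theta> + real j) / \<alpha>) - ln_Gamma (1 + (\<theta> - \<alpha> + real j) / \<alpha>))
             + (ln_Gamma ((real j + 1 - (\<theta> - \<alpha>)) / \<alpha>) - ln_Gamma ((real j + 1 - \<theta>) / \<alpha>)))
       = (\<Sum>j<L. ln (\<theta> + real j) + ln (1 - \<theta> + real j) - 2 * ln \<alpha>)"
    proof (rule sum.cong[OF refl])
      fix j
      have p: "\<theta> + real j > 0" "1 - \<theta> + real j > 0" using \<theta> by auto
      have "ln_Gamma (1 + (\<theta> + real j) / \<alpha>) = ln ((\<theta> + real j) / \<alpha>) + ln_Gamma ((\<theta> + real j) / \<alpha>)"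
        using ln_Gamma_plus1_real[of "(\<theta> + real j) / \<alpha>"] p \<alpha> by (simp add: add_ac)
      moreover have "1 + (\<theta> - \<alpha> + real j) / \<alpha> = (\<theta> + real j) / \<alpha>"
        using \<alpha> by (simp add: field_simps)
      moreover have "ln_Gamma ((real j + 1 - (\<theta> - \<alpha>)) / \<alpha>)
          = ln ((1 - \<theta> + real j) / \<alpha>) + ln_Gamma ((real j + 1 - \<theta>) / \<alpha>)"
      proof -
        have e: "(real j + 1 - (\<theta> - \<alpha>)) / \<alpha> = (1 - \<theta> + real j) / \<alpha> + 1"
             "(real j + 1 - \<theta>) / \<alpha> = (1 - \<theta> + real j) / \<alpha>"
          using \<alpha> by (simp_all add: field_simps)
        show ?thesis
          unfolding e using ln_Gamma_plus1_real[of "(1 - \<theta> + real j) / \<alpha>"] p \<alpha> by simp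
      qed
      ultimately show "(ln_Gamma (1 + (\<theta> + real j) / \<alpha>) - ln_Gamma (1 + (\<theta> - \<alpha> + real j) / \<alpha>))
             + (ln_Gamma ((real j + 1 - (\<theta> - \<alpha>)) / \<alpha>) - ln_Gamma ((real j + 1 - \<theta>) / \<alpha>))
          = ln (\<theta> + real j) + ln (1 - \<theta> + real j) - 2 * ln \<alpha>"
        using p \<alpha> by (simp add: ln_div)
    qed
    also have "\<dots> = (ln_Gamma (\<theta> + real L) - ln_Gamma \<theta>) + (ln_Gamma (1 - \<theta> + real L) - ln_Gamma (1 - \<theta>))
        - 2 * real L * ln \<alpha>"
      using ln_Gamma_plus_of_nat[of \<theta> L] ln_Gamma_plus_of_nat[of "1 - \<theta>" L] \<theta>
      by (simp add: sum_subtractf sum.distrib)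
    also have "(2 * (real L / \<alpha>) * ln (real L / \<alpha>) - 2 * (real L / \<alpha>)) * \<alpha>
        = 2 * real L * ln (real L) - 2 * real L * ln \<alpha> - 2 * real L"
      using \<alpha> that by (simp add: ln_div field_simps)
    finally show ?thesis
      using ln_Gamma_reflection_real[OF \<theta>] by (simp add: add_ac algebra_simps)
  qed
  have "(\<lambda>L. ln_Gamma (real L + \<theta>) + ln_Gamma (real L + 1 - \<theta>)
       - (2 * real L * ln (real L) - 2 * real L + ln (2 * pi))) \<longlonglongrightarrow> 0"
    by (rule filterlim_compose[OF ln_Gamma_pair_at_top filterlim_real_sequentially])
  from tendsto_add[OF this tendsto_const]
  have "(\<lambda>L. ln_Gamma (real L + \<theta>) + ln_Gamma (real L + 1 - \<theta>)
       - (2 * real L * ln (real L) - 2 * real L + ln (2 * pi)) + ln (2 * sin (pi * \<theta>)))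
     \<longlonglongrightarrow> ln (2 * sin (pi * \<theta>))"
    by simp
  then show ?thesis
    by (rule Lim_transform_eventually)
       (auto intro!: eventually_mono[OF eventually_gt_at_top[of 0]] simp: eq)
qed

text \<open>Shifting \<theta> by 1 has the effect of shifting j by 1, so the sum telescopes. The
  terms at j = L cancel against the linear term in the limit; the terms at j = 0 form a reflection
  pair at v = (1 - \<theta>) / \<alpha>.\<close>

lemma log_kernel_wrap_LIMSEQ:
  assumes \<alpha>: "\<alpha> > 0" and \<theta>: "1 - \<alpha> < \<theta>" "\<theta> < 1"
  shows "(\<lambda>L. log_kernel \<alpha> L \<theta> - log_kernel \<alpha> L (\<theta> - 1)) \<longlonglongrightarrow> ln (2 * sin (pi * ((1 - \<theta>) / \<alpha>)))"
proof -
  define v where "v = (1 - \<theta>) / \<alpha>"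
  have v: "0 < v" "v < 1" using \<alpha> \<theta> by (auto simp: v_def field_simps)
  define X where "X = (\<lambda>L. real L / \<alpha>)"
  have eq: "log_kernel \<alpha> L \<theta> - log_kernel \<alpha> L (\<theta> - 1)
     = ln_Gamma (X L + v) + ln_Gamma (X L + 1 - v) - (2 * X L * ln (X L) - 2 * X L + ln (2 * pi))
       + ln (2 * sin (pi * v))" for L
  proof -
    define u where "u = (\<lambda>j. ln_Gamma (1 + (\<theta> - 1 + real j) / \<alpha>))"
    define w where "w = (\<lambda>j. ln_Gamma ((real j + 1 - \<theta>) / \<alpha>))"
    have "log_kernel \<alpha> L \<theta> - log_kernel \<alpha> L (\<theta> - 1)
      = (\<Sum>j<L. (u (Suc j) - u j) + (w (Suc j) - w j)) - (2 * X L * ln (X L) - 2 * X L)"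
      by (simp add: log_kernel_diff u_def w_def X_def add_ac diff_diff_eq2)
    also have "\<dots> = (u L - u 0) + (w L - w 0) - (2 * X L * ln (X L) - 2 * X L)"
      by (simp only: sum.distrib sum_lessThan_telescope)
    finally have "log_kernel \<alpha> L \<theta> - log_kernel \<alpha> L (\<theta> - 1)
      = (u L - u 0) + (w L - w 0) - (2 * X L * ln (X L) - 2 * X L)" .
    moreover have "u L = ln_Gamma (X L + 1 - v)" "u 0 = ln_Gamma (1 - v)"
      "w L = ln_Gamma (X L + v)" "w 0 = ln_Gamma v"
      by (simp_all add: u_def w_def v_def X_def add_divide_distrib diff_divide_distrib algebra_simps)
    ultimately show ?thesis
      using ln_Gamma_reflection_real[OF v] by simp
  qed
  have "filterlim X at_top sequentially"
    unfolding X_def using \<alpha> by real_asymp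
  from filterlim_compose[OF ln_Gamma_pair_at_top this]
  have "(\<lambda>L. ln_Gamma (X L + v) + ln_Gamma (X L + 1 - v) - (2 * X L * ln (X L) - 2 * X L + ln (2 * pi)))
     \<longlonglongrightarrow> 0" .
  from tendsto_add[OF this tendsto_const]
  have "(\<lambda>L. ln_Gamma (X L + v) + ln_Gamma (X L + 1 - v) - (2 * X L * ln (X L) - 2 * X L + ln (2 * pi))
       + ln (2 * sin (pi * v))) \<longlonglongrightarrow> ln (2 * sin (pi * v))"
    by simp
  then show ?thesis by (simp add: eq v_def)
qed

section \<open>Sudler products as limits of the kernel at lattice points\<close>

lemma sin_pi_nat_irrational_neq_0:
  assumes "x \<notin> \<rat>" "n > 0"
  shows "sin (pi * real n * x) \<noteq> 0"
proof
  assume "sin (pi * real n * x) = 0"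
  then obtain i where "pi * real n * x = of_int i * pi" by (auto simp: sin_zero_iff_int2)
  then have "x = of_int i / real n" using assms by (simp add: field_simps)
  then show False using assms by simp
qed

lemma sinprod_pos:
  assumes "x \<notin> \<rat>"
  shows "sinprod N x > 0"
  unfolding sinprod_def using sin_pi_nat_irrational_neq_0[OF assms] by (intro prod_pos) auto

lemma sinprod_Suc: "sinprod (Suc N) x = sinprod N x * \<bar>2 * sin (pi * real (Suc N) * x)\<bar>"
  by (simp add: sinprod_def)

lemma abs_sin_pi_diff_int: "\<bar>sin (pi * (of_int i - x))\<bar> = \<bar>sin (pi * x)\<bar>"
proof -
  have "sin (pi * of_int i) = 0" by (simp add: mult.commute sin_zero_iff_int2)
  moreover have "\<bar>cos (pi * of_int i)\<bar> = 1"
    using sin_cos_squared_add[of "pi * of_int i"] calculation by (simp add: power2_eq_1_iff abs_if) 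
  ultimately show ?thesis by (simp add: right_diff_distrib sin_diff abs_mult)
qed

lemma abs_sin_pi_add_int: "\<bar>sin (pi * (of_int i + x))\<bar> = \<bar>sin (pi * x)\<bar>"
  using abs_sin_pi_diff_int[of i "- x"] by simp

text \<open>The lattice points in the strip form a single staircase path from the origin, and each step
  of the path is one of the two functional equations of the kernel.\<close>
lemma log_kernel_LIMSEQ_sinprod:
  assumes \<alpha>: "0 < \<alpha>" "\<alpha> < 1" "\<alpha> \<notin> \<rat>"
    and "- \<alpha> < real N * \<alpha> - real M" "real N * \<alpha> - real M < 1"
  shows "(\<lambda>L. log_kernel \<alpha> L (real N * \<alpha> - real M)) \<longlonglongrightarrow> ln (sinprod N \<alpha>) - ln (sinprod M (1 / \<alpha>))"
  using assms(4,5)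
proof (induction "N + M" arbitrary: N M rule: less_induct)
  case less
  define \<theta> where "\<theta> = real N * \<alpha> - real M"
  have \<theta>: "- \<alpha> < \<theta>" "\<theta> < 1" using less.prems by (auto simp: \<theta>_def)
  have irr: "1 / \<alpha> \<notin> \<rat>"
  proof
    assume "1 / \<alpha> \<in> \<rat>"
    then have "inverse (1 / \<alpha>) \<in> \<rat>" by (rule Rats_inverse)
    then show False using \<alpha> by simp
  qed
  consider "\<theta> = 0" | "\<theta> > 0" | "\<theta> < 0" by linarith
  then show ?case
  proof cases
    case 1
    have "N = 0"
    proof (rule ccontr)
      assume "N \<noteq> 0"
      then have "\<alpha> = real M / real N" using 1 by (simp add: \<theta>_def field_simps)
      then show False using \<alpha> by simp
    qed
    then show ?thesis using 1 by (simp add: \<theta>_def sinprod_def)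
  next
    case 2
    \<comment> \<open>For \<theta> > 0 the last step of the path raised N: the predecessor \<theta>
      - \<alpha> is still above - \<alpha>, and the new factor of the product is the sine at
      \<theta> because N\<alpha> and \<theta> differ by the integer M.\<close>
    then obtain N' where N: "N = Suc N'" by (cases N) (auto simp: \<theta>_def)
    have t: "real N' * \<alpha> - real M = \<theta> - \<alpha>" by (simp add: \<theta>_def N algebra_simps)
    have IH: "(\<lambda>L. log_kernel \<alpha> L (\<theta> - \<alpha>)) \<longlonglongrightarrow> ln (sinprod N' \<alpha>) - ln (sinprod M (1 / \<alpha>))"
      using less.hyps[of N' M] 2 \<theta> \<alpha> unfolding t by (simp add: N)
    have s: "sin (pi * \<theta>) > 0" using 2 \<theta> by (intro sin_gt_zero) auto
    have e: "pi * real N * \<alpha> = pi * (of_int (int M) + \<theta>)" by (simp add: \<theta>_def algebra_simps)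
    have "\<bar>2 * sin (pi * real N * \<alpha>)\<bar> = 2 * sin (pi * \<theta>)"
      unfolding e
      using abs_sin_pi_add_int[of "int M" \<theta>] s by (simp add: abs_mult)
    then have "ln (sinprod N \<alpha>) = ln (sinprod N' \<alpha>) + ln (2 * sin (pi * \<theta>))"
      using sinprod_pos[OF \<alpha>(3), of N'] s unfolding N sinprod_Suc by (simp add: ln_mult_pos)
    then show ?thesis
      using tendsto_add[OF log_kernel_shift_LIMSEQ[OF \<alpha>(1) 2 \<theta>(2)] IH] unfolding \<theta>_def[symmetric]
      by (simp add: add_ac add_diff_eq)
  next
    case 3
    \<comment> \<open>For \<theta> < 0 the last step raised M: the predecessor \<theta> + 1 lies in
      (1 - \<alpha>, 1), where the wrap equation applies, and M / \<alpha> = N + v identifies the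
      new factor of the product at 1 / \<alpha>.\<close>
    then obtain M' where M: "M = Suc M'" using \<alpha> by (cases M) (auto simp: \<theta>_def mult_less_0_iff)
    have t: "real N * \<alpha> - real M' = \<theta> + 1" by (simp add: \<theta>_def M algebra_simps)
    have IH: "(\<lambda>L. log_kernel \<alpha> L (\<theta> + 1)) \<longlonglongrightarrow> ln (sinprod N \<alpha>) - ln (sinprod M' (1 / \<alpha>))"
      using less.hyps[of N M'] 3 \<theta> \<alpha> unfolding t by (simp add: M)
    define v where "v = - \<theta> / \<alpha>"
    have v: "0 < v" "v < 1" using 3 \<theta> \<alpha> by (auto simp: v_def field_simps)
    have s: "sin (pi * v) > 0" using v by (intro sin_gt_zero) auto
    have e: "pi * real M * (1 / \<alpha>) = pi * (of_int (int N) + v)"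
      using \<alpha> by (simp add: \<theta>_def v_def field_simps)
    have "\<bar>2 * sin (pi * real M * (1 / \<alpha>))\<bar> = 2 * sin (pi * v)"
      unfolding e
      using abs_sin_pi_add_int[of "int N" v] s by (simp add: abs_mult)
    then have eq: "ln (sinprod M (1 / \<alpha>)) = ln (sinprod M' (1 / \<alpha>)) + ln (2 * sin (pi * v))"
      using sinprod_pos[OF irr, of M'] s unfolding M sinprod_Suc by (simp add: ln_mult_pos)
    have "(\<lambda>L. log_kernel \<alpha> L (\<theta> + 1) - log_kernel \<alpha> L \<theta>) \<longlonglongrightarrow> ln (2 * sin (pi * v))"
      using log_kernel_wrap_LIMSEQ[of \<alpha> "\<theta> + 1"] 3 \<theta> \<alpha> by (simp add: v_def)
    from tendsto_diff[OF IH this] show ?thesis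
      unfolding \<theta>_def[symmetric] eq by (simp add: algebra_simps)
  qed
qed

section \<open>Concavity and derivative bounds for the kernel\<close>

definition log_kernel' :: "real \<Rightarrow> nat \<Rightarrow> real \<Rightarrow> real" where
  "log_kernel' \<alpha> L \<theta> =
     (\<Sum>j<L. (Digamma (1 + (\<theta> + real j) / \<alpha>) + Digamma ((real j + 1 - \<theta>) / \<alpha>)) / \<alpha>)
     - (2 * (real L / \<alpha>) * ln (real L / \<alpha>) - 2 * (real L / \<alpha>))"

definition log_kernel'' :: "real \<Rightarrow> nat \<Rightarrow> real \<Rightarrow> real" where
  "log_kernel'' \<alpha> L \<theta> =
     (\<Sum>j<L. (Polygamma 1 (1 + (\<theta> + real j) / \<alpha>) - Polygamma 1 ((real j + 1 - \<theta>) / \<alpha>)) / \<alpha>\<^sup>2)"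

lemma log_kernel_argument_eq:
  "\<alpha> > 0 \<Longrightarrow> 1 + (\<theta> + real j) / \<alpha> = (\<alpha> + \<theta> + real j) / \<alpha>"
  by (simp add: field_simps)

lemma log_kernel_arguments_pos:
  assumes "\<alpha> > 0" "- \<alpha> < \<theta>" "\<theta> < 1"
  shows "1 + (\<theta> + real j) / \<alpha> > 0" "(real j + 1 - \<theta>) / \<alpha> > 0"
proof -
  have "\<alpha> + (\<theta> + real j) > 0" "real j + 1 - \<theta> > 0" using assms by linarith+
  then show "1 + (\<theta> + real j) / \<alpha> > 0" "(real j + 1 - \<theta>) / \<alpha> > 0"
    using assms by (simp_all add: field_simps)
qed

lemma log_kernel_arguments_has_derivative:
  assumes "\<alpha> > 0" "- \<alpha> < \<theta>" "\<theta> < 1"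
    and "\<And>x. x > 0 \<Longrightarrow> (f has_real_derivative f' x) (at x)"
  shows "((\<lambda>\<theta>. f (1 + (\<theta> + real j) / \<alpha>)) has_real_derivative f' (1 + (\<theta> + real j) / \<alpha>) / \<alpha>) (at \<theta>)"
    and "((\<lambda>\<theta>. f ((real j + 1 - \<theta>) / \<alpha>)) has_real_derivative - f' ((real j + 1 - \<theta>) / \<alpha>) / \<alpha>) (at \<theta>)"
proof -
  note p = log_kernel_arguments_pos[OF assms(1-3), of j]
  have "((\<lambda>\<theta>. 1 + (\<theta> + real j) / \<alpha>) has_real_derivative 1 / \<alpha>) (at \<theta>)"
    using assms(1) by (auto intro!: derivative_eq_intros)
  from DERIV_chain2[OF assms(4)[OF p(1)] this]
  show "((\<lambda>\<theta>. f (1 + (\<theta> + real j) / \<alpha>)) has_real_derivative f' (1 + (\<theta> + real j) / \<alpha>) / \<alpha>) (at \<theta>)"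
    by simp
  have "((\<lambda>\<theta>. (real j + 1 - \<theta>) / \<alpha>) has_real_derivative - 1 / \<alpha>) (at \<theta>)"
    using assms(1) by (auto intro!: derivative_eq_intros)
  from DERIV_chain2[OF assms(4)[OF p(2)] this]
  show "((\<lambda>\<theta>. f ((real j + 1 - \<theta>) / \<alpha>)) has_real_derivative - f' ((real j + 1 - \<theta>) / \<alpha>) / \<alpha>) (at \<theta>)"
    by simp
qed

lemma log_kernel_has_derivative:
  assumes "\<alpha> > 0" "- \<alpha> < \<theta>" "\<theta> < 1"
  shows "(log_kernel \<alpha> L has_real_derivative log_kernel' \<alpha> L \<theta>) (at \<theta>)"
proof -
  define A where "A = 2 * (real L / \<alpha>) * ln (real L / \<alpha>) - 2 * (real L / \<alpha>)"
  have "((\<lambda>\<theta>. \<Sum>j<L. ln_Gamma (1 + (\<theta> + real j) / \<alpha>) - ln_Gamma ((real j + 1 - \<theta>) / \<alpha>)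
          - (ln_Gamma (1 + real j / \<alpha>) - ln_Gamma ((real j + 1) / \<alpha>))) has_real_derivative
     (\<Sum>j<L. (Digamma (1 + (\<theta> + real j) / \<alpha>) + Digamma ((real j + 1 - \<theta>) / \<alpha>)) / \<alpha>)) (at \<theta>)"
  proof (rule DERIV_sum)
    fix j
    note d = log_kernel_arguments_has_derivative[OF assms has_field_derivative_ln_Gamma_real, of j]
    show "((\<lambda>\<theta>. ln_Gamma (1 + (\<theta> + real j) / \<alpha>) - ln_Gamma ((real j + 1 - \<theta>) / \<alpha>)
          - (ln_Gamma (1 + real j / \<alpha>) - ln_Gamma ((real j + 1) / \<alpha>))) has_real_derivative
       (Digamma (1 + (\<theta> + real j) / \<alpha>) + Digamma ((real j + 1 - \<theta>) / \<alpha>)) / \<alpha>) (at \<theta>)"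
      using DERIV_diff[OF DERIV_diff[OF d] DERIV_const] by (simp add: add_divide_distrib)
  qed
  then have "((\<lambda>\<theta>. (\<Sum>j<L. ln_Gamma (1 + (\<theta> + real j) / \<alpha>) - ln_Gamma ((real j + 1 - \<theta>) / \<alpha>)
          - (ln_Gamma (1 + real j / \<alpha>) - ln_Gamma ((real j + 1) / \<alpha>))) - A * \<theta>) has_real_derivative
     (\<Sum>j<L. (Digamma (1 + (\<theta> + real j) / \<alpha>) + Digamma ((real j + 1 - \<theta>) / \<alpha>)) / \<alpha>) - A) (at \<theta>)"
    using DERIV_diff[OF _ DERIV_cmult_Id[of A]] by blast
  then show ?thesis
    unfolding log_kernel_def[abs_def] log_kernel'_def A_def .
qed

lemma log_kernel'_has_derivative:
  assumes "\<alpha> > 0" "- \<alpha> < \<theta>" "\<theta> < 1"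
  shows "(log_kernel' \<alpha> L has_real_derivative log_kernel'' \<alpha> L \<theta>) (at \<theta>)"
proof -
  have n: "x \<notin> \<int>\<^sub>\<le>\<^sub>0" if "x > 0" for x :: real using that by (auto elim!: nonpos_Ints_cases)
  define A where "A = 2 * (real L / \<alpha>) * ln (real L / \<alpha>) - 2 * (real L / \<alpha>)"
  have "((\<lambda>\<theta>. \<Sum>j<L. (Digamma (1 + (\<theta> + real j) / \<alpha>) + Digamma ((real j + 1 - \<theta>) / \<alpha>)) / \<alpha>) has_real_derivative
     (\<Sum>j<L. (Polygamma 1 (1 + (\<theta> + real j) / \<alpha>) - Polygamma 1 ((real j + 1 - \<theta>) / \<alpha>)) / \<alpha>\<^sup>2)) (at \<theta>)"
  proof (rule DERIV_sum)
    fix j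
    have D: "(Digamma has_real_derivative Polygamma 1 x) (at x)" if "x > 0" for x :: real
      using has_field_derivative_Polygamma[OF n[OF that], of 0] by simp
    note d = log_kernel_arguments_has_derivative[OF assms D, of j]
    show "((\<lambda>\<theta>. (Digamma (1 + (\<theta> + real j) / \<alpha>) + Digamma ((real j + 1 - \<theta>) / \<alpha>)) / \<alpha>) has_real_derivative
       (Polygamma 1 (1 + (\<theta> + real j) / \<alpha>) - Polygamma 1 ((real j + 1 - \<theta>) / \<alpha>)) / \<alpha>\<^sup>2) (at \<theta>)"
      using DERIV_cdivide[OF DERIV_add[OF d], of \<alpha>] by (simp add: power2_eq_square diff_divide_distrib)
  qed
  then have "((\<lambda>\<theta>. (\<Sum>j<L. (Digamma (1 + (\<theta> + real j) / \<alpha>) + Digamma ((real j + 1 - \<theta>) / \<alpha>)) / \<alpha>) - A) has_real_derivative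
     (\<Sum>j<L. (Polygamma 1 (1 + (\<theta> + real j) / \<alpha>) - Polygamma 1 ((real j + 1 - \<theta>) / \<alpha>)) / \<alpha>\<^sup>2)) (at \<theta>)"
    using DERIV_diff[OF _ DERIV_const[of A]] by simp
  then show ?thesis
    unfolding log_kernel'_def[abs_def] log_kernel''_def A_def .
qed

lemma trigamma_antimono:
  assumes "0 < x" "x \<le> (y::real)"
  shows "Polygamma 1 y \<le> Polygamma 1 x"
  using Polygamma_real_strict_antimono[of x y 1] assms by (cases "x = y") auto

lemma trigamma_pos: "(x::real) > 0 \<Longrightarrow> Polygamma 1 x > 0"
  by (rule Polygamma_real_odd_pos) (auto elim!: nonpos_Ints_cases)

text \<open>The point (1 - \<alpha>) / 2 is the centre of the strip (- \<alpha>, 1). To its right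
  the first trigamma argument in each summand of \<open>log_kernel''\<close> is at least the second
  one, and trigamma decreases, so every summand is nonpositive.\<close>

lemma log_kernel'_antimono:
  assumes "\<alpha> > 0" "(1 - \<alpha>) / 2 \<le> s" "s \<le> t" "t < 1"
  shows "log_kernel' \<alpha> L t \<le> log_kernel' \<alpha> L s"
proof (rule DERIV_nonpos_imp_nonincreasing[OF assms(3)])
  fix x assume x: "s \<le> x" "x \<le> t"
  then have x': "- \<alpha> < x" "x < 1" "(1 - \<alpha>) / 2 \<le> x" using assms by auto
  have "log_kernel'' \<alpha> L x \<le> 0"
    unfolding log_kernel''_def
  proof (rule sum_nonpos)
    fix j
    have "(real j + 1 - x) / \<alpha> \<le> 1 + (x + real j) / \<alpha>"
      unfolding log_kernel_argument_eq[OF assms(1)] using x' assms(1)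
      by (intro divide_right_mono) auto
    from trigamma_antimono[OF _ this] log_kernel_arguments_pos(2)[OF assms(1) x'(1,2), of j]
    have "Polygamma 1 (1 + (x + real j) / \<alpha>) - Polygamma 1 ((real j + 1 - x) / \<alpha>) \<le> 0" by simp
    then show "(Polygamma 1 (1 + (x + real j) / \<alpha>) - Polygamma 1 ((real j + 1 - x) / \<alpha>)) / \<alpha>\<^sup>2 \<le> 0"
      by (rule divide_nonpos_nonneg) simp
  qed
  then show "\<exists>y. (log_kernel' \<alpha> L has_real_derivative y) (at x) \<and> y \<le> 0"
    using log_kernel'_has_derivative[OF assms(1) x'(1,2)] by blast
qed

lemma log_kernel_MVT:
  assumes "\<alpha> > 0" "- \<alpha> < s" "s \<le> t" "t < 1"
  obtains \<xi> where "s \<le> \<xi>" "\<xi> \<le> t" "log_kernel \<alpha> L t - log_kernel \<alpha> L s = (t - s) * log_kernel' \<alpha> L \<xi>"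
proof (cases "s = t")
  case True
  then show ?thesis using that[of s] by simp
next
  case False
  then have "\<exists>\<xi>. s < \<xi> \<and> \<xi> < t \<and> log_kernel \<alpha> L t - log_kernel \<alpha> L s = (t - s) * log_kernel' \<alpha> L \<xi>"
    using assms by (intro MVT2 log_kernel_has_derivative) auto
  then show ?thesis using that by (meson less_imp_le)
qed

text \<open>The Bohr-Mollerup sandwich: by concavity, chord slopes decrease over [p - \<alpha>, p],
  [p, \<theta>] and [\<theta>, p + \<alpha>]. The outer bounds involve only increments over a full
  step \<alpha>, whose limits are known from the shift equation.\<close>

lemma log_kernel_concave_bounds:
  assumes \<alpha>: "\<alpha> > 0" and p: "(1 - \<alpha>) / 2 \<le> p - \<alpha>" "p \<le> \<theta>" "\<theta> \<le> p + \<alpha>" "p + \<alpha> < 1"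
  shows "(\<theta> - p) / \<alpha> * (log_kernel \<alpha> L (p + \<alpha>) - log_kernel \<alpha> L p) \<le> log_kernel \<alpha> L \<theta> - log_kernel \<alpha> L p"
    and "log_kernel \<alpha> L \<theta> - log_kernel \<alpha> L p \<le> (\<theta> - p) / \<alpha> * (log_kernel \<alpha> L p - log_kernel \<alpha> L (p - \<alpha>))"
proof -
  obtain x where x: "p - \<alpha> \<le> x" "x \<le> p"
      "log_kernel \<alpha> L p - log_kernel \<alpha> L (p - \<alpha>) = (p - (p - \<alpha>)) * log_kernel' \<alpha> L x"
    by (rule log_kernel_MVT[of \<alpha> "p - \<alpha>" p L]) (use assms in auto)
  obtain y where y: "p \<le> y" "y \<le> \<theta>"
      "log_kernel \<alpha> L \<theta> - log_kernel \<alpha> L p = (\<theta> - p) * log_kernel' \<alpha> L y"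
    by (rule log_kernel_MVT[of \<alpha> p \<theta> L]) (use assms in auto)
  obtain z where z: "\<theta> \<le> z" "z \<le> p + \<alpha>"
      "log_kernel \<alpha> L (p + \<alpha>) - log_kernel \<alpha> L \<theta> = (p + \<alpha> - \<theta>) * log_kernel' \<alpha> L z"
    by (rule log_kernel_MVT[of \<alpha> \<theta> "p + \<alpha>" L]) (use assms in auto)
  have xy: "log_kernel' \<alpha> L y \<le> log_kernel' \<alpha> L x"
    by (rule log_kernel'_antimono) (use assms x y in auto)
  have yz: "log_kernel' \<alpha> L z \<le> log_kernel' \<alpha> L y"
    by (rule log_kernel'_antimono) (use assms y z in auto)
  have "(\<theta> - p) * log_kernel' \<alpha> L y \<le> (\<theta> - p) * log_kernel' \<alpha> L x"
    using p xy by (intro mult_left_mono) auto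
  then show "log_kernel \<alpha> L \<theta> - log_kernel \<alpha> L p \<le> (\<theta> - p) / \<alpha> * (log_kernel \<alpha> L p - log_kernel \<alpha> L (p - \<alpha>))"
    using \<alpha> x(3) y(3) by simp
  have "log_kernel \<alpha> L (p + \<alpha>) - log_kernel \<alpha> L p
      = (\<theta> - p) * log_kernel' \<alpha> L y + (p + \<alpha> - \<theta>) * log_kernel' \<alpha> L z"
    using y(3) z(3) by linarith
  also have "\<dots> \<le> (\<theta> - p) * log_kernel' \<alpha> L y + (p + \<alpha> - \<theta>) * log_kernel' \<alpha> L y"
    using p yz by (intro add_left_mono mult_left_mono) auto
  also have "\<dots> = \<alpha> * log_kernel' \<alpha> L y" by (simp add: algebra_simps)
  finally have "(\<theta> - p) / \<alpha> * (log_kernel \<alpha> L (p + \<alpha>) - log_kernel \<alpha> L p)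
      \<le> (\<theta> - p) / \<alpha> * (\<alpha> * log_kernel' \<alpha> L y)"
    using p \<alpha> by (intro mult_left_mono) auto
  then show "(\<theta> - p) / \<alpha> * (log_kernel \<alpha> L (p + \<alpha>) - log_kernel \<alpha> L p) \<le> log_kernel \<alpha> L \<theta> - log_kernel \<alpha> L p"
    using \<alpha> y(3) by simp
qed

section \<open>Bounds on the kernel that are uniform in L\<close>

lemma sum_diff_two_steps:
  fixes f :: "nat \<Rightarrow> real"
  shows "(\<Sum>j<n. f j - f (j + 2)) = f 0 + f 1 - f n - f (n + 1)"
  by (induction n) auto

text \<open>Replacing x j by the larger y (j + 2) can only increase the sum, which then telescopes
  in steps of two and leaves two positive terms, whatever L is.\<close>

lemma interlaced_trigamma_sum_bound:
  fixes x y :: "nat \<Rightarrow> real"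
  assumes "c > 0" "\<And>j. y j \<ge> c" "\<And>j. x j > 0" "\<And>j. x j \<le> y (j + 2)"
  shows "(\<Sum>j<L. Polygamma 1 (y j) - Polygamma 1 (x j)) \<le> 2 * Polygamma 1 c"
proof -
  have y: "Polygamma 1 (y j) \<ge> 0" "Polygamma 1 (y j) \<le> Polygamma 1 c" for j
    using trigamma_pos[of "y j"] trigamma_antimono[of c "y j"] assms(1) assms(2)[of j] by auto
  have "(\<Sum>j<L. Polygamma 1 (y j) - Polygamma 1 (x j)) \<le> (\<Sum>j<L. Polygamma 1 (y j) - Polygamma 1 (y (j + 2)))"
    using assms by (intro sum_mono diff_left_mono trigamma_antimono) auto
  also have "\<dots> = Polygamma 1 (y 0) + Polygamma 1 (y 1) - Polygamma 1 (y L) - Polygamma 1 (y (L + 1))"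
    by (rule sum_diff_two_steps)
  also have "\<dots> \<le> 2 * Polygamma 1 c"
    using y(2)[of 0] y(2)[of 1] y(1)[of L] y(1)[of "L + 1"] by linarith
  finally show ?thesis .
qed

text \<open>The range of \<theta> stays \<alpha> / 6 away from both ends of the strip, which keeps
  all trigamma arguments at least 1/6. The two families of arguments interlace with an index offset
  of two, so the previous lemma applies in both directions.\<close>

lemma log_kernel''_bound:
  assumes \<alpha>: "0 < \<alpha>" "\<alpha> < 1" and \<theta>: "- (5/6) * \<alpha> \<le> \<theta>" "\<theta> \<le> 1 - \<alpha> / 6"
  shows "\<bar>log_kernel'' \<alpha> L \<theta>\<bar> \<le> 2 * Polygamma 1 (1/6) / \<alpha>\<^sup>2"
proof -
  define x where "x = (\<lambda>j. 1 + (\<theta> + real j) / \<alpha>)"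
  define y where "y = (\<lambda>j. (real j + 1 - \<theta>) / \<alpha>)"
  have x: "x j \<ge> 1/6" for j
  proof -
    have "\<alpha> * (1/6) \<le> \<alpha> + (\<theta> + real j)" using \<theta> by simp
    then show ?thesis using \<alpha> by (simp add: x_def field_simps)
  qed
  have y: "y j \<ge> 1/6" for j
  proof -
    have "\<alpha> * (1/6) \<le> real j + 1 - \<theta>" using \<theta> by simp
    then show ?thesis using \<alpha> by (simp add: y_def field_simps)
  qed
  have xy: "x j \<le> y (j + 2)" "y j \<le> x (j + 2)" for j
    unfolding x_def y_def log_kernel_argument_eq[OF \<alpha>(1)] using \<alpha> \<theta>
    by (auto intro!: divide_right_mono)
  have pos: "x j > 0" "y j > 0" for j
    using x[of j] y[of j] by linarith+
  have "(\<Sum>j<L. Polygamma 1 (y j) - Polygamma 1 (x j)) \<le> 2 * Polygamma 1 (1/6)"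
    by (rule interlaced_trigamma_sum_bound) (use x y xy pos in auto)
  moreover have "(\<Sum>j<L. Polygamma 1 (x j) - Polygamma 1 (y j)) \<le> 2 * Polygamma 1 (1/6)"
    by (rule interlaced_trigamma_sum_bound) (use x y xy pos in auto)
  ultimately have "\<bar>\<Sum>j<L. Polygamma 1 (x j) - Polygamma 1 (y j)\<bar> \<le> 2 * Polygamma 1 (1/6)"
    by (simp add: sum_subtractf)
  then show ?thesis
    unfolding log_kernel''_def x_def y_def sum_divide_distrib[symmetric]
    using \<alpha> by (simp add: divide_right_mono)
qed

text \<open>The interval from - \<alpha> / 2 to 1 - \<alpha> / 2 has length 1, so the mean value
  theorem finds a point where the derivative equals the wrap difference. The second derivative bound
  carries this to the whole range, of length below 2, and integration from
  \<open>log_kernel \<alpha> L 0 = 0\<close> bounds the kernel.\<close>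

lemma log_kernel_bound:
  assumes \<alpha>: "0 < \<alpha>" "\<alpha> < 1" and \<theta>: "- (5/6) * \<alpha> \<le> \<theta>" "\<theta> \<le> 1 - \<alpha> / 6"
  shows "\<bar>log_kernel \<alpha> L \<theta>\<bar>
    \<le> \<bar>log_kernel \<alpha> L (1 - \<alpha> / 2) - log_kernel \<alpha> L (- \<alpha> / 2)\<bar> + 4 * Polygamma 1 (1/6) / \<alpha>\<^sup>2"
proof -
  define I where "I = {- (5/6) * \<alpha> .. 1 - \<alpha> / 6}"
  have I: "- \<alpha> < x" "x < 1" if "x \<in> I" for x using that \<alpha> by (auto simp: I_def)
  obtain \<xi> where \<xi>: "- \<alpha> / 2 \<le> \<xi>" "\<xi> \<le> 1 - \<alpha> / 2"
    "log_kernel \<alpha> L (1 - \<alpha> / 2) - log_kernel \<alpha> L (- \<alpha> / 2) = (1 - \<alpha> / 2 - (- \<alpha> / 2)) * log_kernel' \<alpha> L \<xi>"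
    by (rule log_kernel_MVT[of \<alpha> "- \<alpha> / 2" "1 - \<alpha> / 2" L]) (use \<alpha> in auto)
  have \<xi>I: "\<xi> \<in> I" using \<xi> \<alpha> by (auto simp: I_def)
  have P: "Polygamma 1 (1/6 :: real) \<ge> 0" using trigamma_pos[of "1/6"] by simp
  have D: "\<bar>log_kernel' \<alpha> L x\<bar>
      \<le> \<bar>log_kernel \<alpha> L (1 - \<alpha> / 2) - log_kernel \<alpha> L (- \<alpha> / 2)\<bar> + 4 * Polygamma 1 (1/6) / \<alpha>\<^sup>2"
    if x: "x \<in> I" for x
  proof -
    have "norm (log_kernel' \<alpha> L x - log_kernel' \<alpha> L \<xi>) \<le> 2 * Polygamma 1 (1/6) / \<alpha>\<^sup>2 * norm (x - \<xi>)"
    proof (rule field_differentiable_bound[of I])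
      show "convex I" by (simp add: I_def)
      show "(log_kernel' \<alpha> L has_field_derivative log_kernel'' \<alpha> L z) (at z within I)" if "z \<in> I" for z
        using log_kernel'_has_derivative[OF \<alpha>(1) I[OF that]] has_field_derivative_at_within by blast
      show "norm (log_kernel'' \<alpha> L z) \<le> 2 * Polygamma 1 (1/6) / \<alpha>\<^sup>2" if "z \<in> I" for z
        using log_kernel''_bound[OF \<alpha>, of z L] that by (simp add: I_def)
    qed (use x \<xi>I in auto)
    also have "norm (x - \<xi>) \<le> 2" using x \<xi>I \<alpha> by (auto simp: I_def)
    then have "2 * Polygamma 1 (1/6) / \<alpha>\<^sup>2 * norm (x - \<xi>) \<le> 2 * Polygamma 1 (1/6) / \<alpha>\<^sup>2 * 2"
      using P by (intro mult_left_mono) auto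
    finally show ?thesis using \<xi>(3) by simp
  qed
  have "norm (log_kernel \<alpha> L \<theta> - log_kernel \<alpha> L 0)
      \<le> (\<bar>log_kernel \<alpha> L (1 - \<alpha> / 2) - log_kernel \<alpha> L (- \<alpha> / 2)\<bar> + 4 * Polygamma 1 (1/6) / \<alpha>\<^sup>2) * norm (\<theta> - 0)"
  proof (rule field_differentiable_bound[of I])
    show "convex I" by (simp add: I_def)
    show "(log_kernel \<alpha> L has_field_derivative log_kernel' \<alpha> L z) (at z within I)" if "z \<in> I" for z
      using log_kernel_has_derivative[OF \<alpha>(1) I[OF that]] has_field_derivative_at_within by blast
    show "\<theta> \<in> I" "0 \<in> I" using \<theta> \<alpha> by (auto simp: I_def)
  qed (use D in simp)
  also have "\<dots> \<le> (\<bar>log_kernel \<alpha> L (1 - \<alpha> / 2) - log_kernel \<alpha> L (- \<alpha> / 2)\<bar> + 4 * Polygamma 1 (1/6) / \<alpha>\<^sup>2) * 1"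
    using \<theta> \<alpha> P by (intro mult_left_mono) auto
  finally show ?thesis by simp
qed

text \<open>A crude estimate, only of use when \<alpha> is bounded away from 0.\<close>

lemma renormalization_bound:
  assumes \<alpha>: "0 < \<alpha>" "\<alpha> < 1" "\<alpha> \<notin> \<rat>"
    and \<theta>: "- (5/6) * \<alpha> \<le> real N * \<alpha> - real M" "real N * \<alpha> - real M \<le> 1 - \<alpha> / 6"
  shows "\<bar>ln (sinprod N \<alpha>) - ln (sinprod M (1 / \<alpha>))\<bar> \<le> ln 2 + 4 * Polygamma 1 (1/6) / \<alpha>\<^sup>2"
proof (rule LIMSEQ_le)
  show "(\<lambda>L. \<bar>log_kernel \<alpha> L (real N * \<alpha> - real M)\<bar>) \<longlonglongrightarrow> \<bar>ln (sinprod N \<alpha>) - ln (sinprod M (1 / \<alpha>))\<bar>"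
    using \<theta> \<alpha> by (intro tendsto_rabs log_kernel_LIMSEQ_sinprod) auto
  \<comment> \<open>At \<theta> = 1 - \<alpha> / 2 the wrap equation has v = 1/2, where 2 sin (pi v)
    = 2.\<close>
  have "(\<lambda>L. log_kernel \<alpha> L (1 - \<alpha> / 2) - log_kernel \<alpha> L (- \<alpha> / 2)) \<longlonglongrightarrow> ln 2"
    using log_kernel_wrap_LIMSEQ[of \<alpha> "1 - \<alpha> / 2"] \<alpha> by simp
  then have "(\<lambda>L. \<bar>log_kernel \<alpha> L (1 - \<alpha> / 2) - log_kernel \<alpha> L (- \<alpha> / 2)\<bar>) \<longlonglongrightarrow> \<bar>ln 2\<bar>"
    by (rule tendsto_rabs)
  then show "(\<lambda>L. \<bar>log_kernel \<alpha> L (1 - \<alpha> / 2) - log_kernel \<alpha> L (- \<alpha> / 2)\<bar> + 4 * Polygamma 1 (1/6) / \<alpha>\<^sup>2)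
      \<longlonglongrightarrow> ln 2 + 4 * Polygamma 1 (1/6) / \<alpha>\<^sup>2"
    by (intro tendsto_intros) simp
qed (use log_kernel_bound[OF \<alpha>(1,2) \<theta>] in auto)

text \<open>The concavity sandwich with base point n\<alpha> passes to the limit. Both bounds are a
  fraction in [0, 1] of ln (2 sin) at n\<alpha> or n\<alpha> + \<alpha>; near 5/6 these logarithms
  are small.\<close>

lemma renormalization_compare:
  assumes \<alpha>: "0 < \<alpha>" "\<alpha> < 1" "\<alpha> \<notin> \<rat>"
    and p: "(1 - \<alpha>) / 2 \<le> real n * \<alpha> - \<alpha>" "real n * \<alpha> + \<alpha> < 1"
    and \<theta>: "real n * \<alpha> \<le> real N * \<alpha> - real M" "real N * \<alpha> - real M \<le> real n * \<alpha> + \<alpha>"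
    and B: "\<bar>ln (2 * sin (pi * (real n * \<alpha>)))\<bar> \<le> B" "\<bar>ln (2 * sin (pi * (real n * \<alpha> + \<alpha>)))\<bar> \<le> B"
  shows "\<bar>ln (sinprod N \<alpha>) - ln (sinprod M (1 / \<alpha>)) - ln (sinprod n \<alpha>)\<bar> \<le> B"
proof -
  define q where "q = real n * \<alpha>"
  define t where "t = real N * \<alpha> - real M"
  define \<Phi> where "\<Phi> = ln (sinprod N \<alpha>) - ln (sinprod M (1 / \<alpha>))"
  have q: "(1 - \<alpha>) / 2 \<le> q - \<alpha>" "q + \<alpha> < 1" "q \<le> t" "t \<le> q + \<alpha>" "q > 0"
    using p \<theta> \<alpha> by (auto simp: q_def t_def)
  have "(\<lambda>L. log_kernel \<alpha> L t) \<longlonglongrightarrow> \<Phi>"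
    unfolding t_def \<Phi>_def using \<alpha> q by (intro log_kernel_LIMSEQ_sinprod) (auto simp: t_def)
  \<comment> \<open>The base point is the lattice point (n, 0), whose second Sudler product is
    empty.\<close>
  moreover have kq: "(\<lambda>L. log_kernel \<alpha> L q) \<longlonglongrightarrow> ln (sinprod n \<alpha>)"
    using log_kernel_LIMSEQ_sinprod[OF \<alpha>, of n 0] q \<alpha> by (simp add: q_def sinprod_def)
  ultimately have lim: "(\<lambda>L. log_kernel \<alpha> L t - log_kernel \<alpha> L q) \<longlonglongrightarrow> \<Phi> - ln (sinprod n \<alpha>)"
    by (rule tendsto_diff)
  have l1: "(\<lambda>L. (t - q) / \<alpha> * (log_kernel \<alpha> L (q + \<alpha>) - log_kernel \<alpha> L q))
      \<longlonglongrightarrow> (t - q) / \<alpha> * ln (2 * sin (pi * (q + \<alpha>)))"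
    using log_kernel_shift_LIMSEQ[of \<alpha> "q + \<alpha>"] q \<alpha> by (intro tendsto_mult_left) simp
  have l2: "(\<lambda>L. (t - q) / \<alpha> * (log_kernel \<alpha> L q - log_kernel \<alpha> L (q - \<alpha>)))
      \<longlonglongrightarrow> (t - q) / \<alpha> * ln (2 * sin (pi * q))"
    using log_kernel_shift_LIMSEQ[of \<alpha> q] q \<alpha> by (intro tendsto_mult_left) simp
  have c: "0 \<le> (t - q) / \<alpha>" "(t - q) / \<alpha> \<le> 1" using q \<alpha> by (auto simp: field_simps)
  have sc: "\<bar>(t - q) / \<alpha> * z\<bar> \<le> B" if "\<bar>z\<bar> \<le> B" for z
  proof -
    have "\<bar>(t - q) / \<alpha> * z\<bar> = (t - q) / \<alpha> * \<bar>z\<bar>"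
      by (simp only: abs_mult abs_of_nonneg[OF c(1)])
    also have "\<dots> \<le> 1 * \<bar>z\<bar>" using c by (intro mult_right_mono) auto
    finally show ?thesis using that by simp
  qed
  have "(t - q) / \<alpha> * ln (2 * sin (pi * (q + \<alpha>))) \<le> \<Phi> - ln (sinprod n \<alpha>)"
    by (rule LIMSEQ_le[OF l1 lim]) (use log_kernel_concave_bounds(1)[of \<alpha> q t] q \<alpha> in auto)
  moreover have "\<Phi> - ln (sinprod n \<alpha>) \<le> (t - q) / \<alpha> * ln (2 * sin (pi * q))"
    by (rule LIMSEQ_le[OF lim l2]) (use log_kernel_concave_bounds(2)[of \<alpha> q t] q \<alpha> in auto)
  ultimately show ?thesis
    using sc[OF B(1)] sc[OF B(2)] unfolding \<Phi>_def[symmetric] q_def[symmetric] by linarith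
qed

section \<open>Initial segments of Sudler products\<close>

text \<open>Let E(t) be the trapezoid error on [a, t]. Its derivative is half a first-order Taylor
  remainder of h expanded at t, hence at most B (b - a)^2 / 2 in absolute value; the mean value
  inequality from E(a) = 0 supplies the third factor b - a.\<close>

lemma trapezoid_error_bound:
  fixes H h h' h'' :: "real \<Rightarrow> real"
  assumes ab: "a \<le> b"
    and H: "\<And>x. x \<in> {a..b} \<Longrightarrow> (H has_real_derivative h x) (at x)"
    and h: "\<And>x. x \<in> {a..b} \<Longrightarrow> (h has_real_derivative h' x) (at x)"
    and h': "\<And>x. x \<in> {a..b} \<Longrightarrow> (h' has_real_derivative h'' x) (at x)"
    and B: "\<And>x. x \<in> {a..b} \<Longrightarrow> \<bar>h'' x\<bar> \<le> B"
  shows "\<bar>H b - H a - (b - a) * (h a + h b) / 2\<bar> \<le> B / 2 * (b - a) ^ 3"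
proof -
  define E where "E = (\<lambda>t. H t - H a - (t - a) * (h a + h t) / 2)"
  have B0: "B \<ge> 0" using B[of a] ab by auto
  have "norm (E b - E a) \<le> B / 2 * (b - a)\<^sup>2 * norm (b - a)"
  proof (rule field_differentiable_bound[of "{a..b}"])
    show "(E has_field_derivative h t - ((h a + h t) + (t - a) * h' t) / 2) (at t within {a..b})"
      if "t \<in> {a..b}" for t
      unfolding E_def
      by (rule has_field_derivative_at_within)
         (use that in \<open>auto intro!: derivative_eq_intros H h simp: field_simps\<close>)
    show "norm (h t - ((h a + h t) + (t - a) * h' t) / 2) \<le> B / 2 * (b - a)\<^sup>2" if t: "t \<in> {a..b}" for t
    proof -
      \<comment> \<open>Taylor remainder: subtract the linear function with slope h' t and apply the
        mean value inequality to what is left.\<close>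
      have "norm (h a - h t - (a - t) * h' t) \<le> norm (a - t) * (B * norm (b - a))"
      proof -
        have "norm ((h a - h' t * a) - (h t - h' t * t)) \<le> B * norm (b - a) * norm (a - t)"
        proof (rule field_differentiable_bound[of "{a..t}" "\<lambda>s. h s - h' t * s" "\<lambda>s. h' s - h' t"])
          show "((\<lambda>s. h s - h' t * s) has_field_derivative h' s - h' t) (at s within {a..t})"
            if "s \<in> {a..t}" for s
            by (rule has_field_derivative_at_within)
               (use that t in \<open>auto intro!: derivative_eq_intros h\<close>)
          show "norm (h' s - h' t) \<le> B * norm (b - a)" if s: "s \<in> {a..t}" for s
          proof -
            have "norm (h' s - h' t) \<le> B * norm (s - t)"
            proof (rule field_differentiable_bound[of "{a..b}" h' h''])
              show "(h' has_field_derivative h'' z) (at z within {a..b})" if "z \<in> {a..b}" for z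
                using h'[OF that] by (rule has_field_derivative_at_within)
            qed (use s t B in auto)
            also have "\<dots> \<le> B * norm (b - a)" using s t B0 by (intro mult_left_mono) auto
            finally show ?thesis .
          qed
        qed (use t in auto)
        then show ?thesis by (simp add: algebra_simps)
      qed
      also have "\<dots> \<le> (b - a) * (B * norm (b - a))" using t B0 by (intro mult_right_mono) auto
      finally have "\<bar>h a - h t - (a - t) * h' t\<bar> \<le> B * (b - a)\<^sup>2"
        using ab by (simp add: power2_eq_square algebra_simps)
      moreover have "h t - ((h a + h t) + (t - a) * h' t) / 2 = - (h a - h t - (a - t) * h' t) / 2"
        by (simp add: field_simps)
      ultimately show ?thesis by (simp only: real_norm_def abs_divide abs_minus_cancel) simp
    qed
  qed (use ab in auto)
  then show ?thesis
    using ab by (simp add: E_def power3_eq_cube power2_eq_square mult.assoc)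
qed

text \<open>This is ln (sin (pi x) / (pi x)), written through the reflection formula so as to be smooth at 0.\<close>
definition log_sinc :: "real \<Rightarrow> real" where
  "log_sinc x = - ln_Gamma (1 + x) - ln_Gamma (1 - x)"

lemma log_sinc_0 [simp]: "log_sinc 0 = 0"
  by (simp add: log_sinc_def ln_Gamma_real_pos)

lemma ln_sin_eq_log_sinc:
  assumes "0 < x" "x < 1"
  shows "ln (2 * sin (pi * x)) = ln (2 * pi * x) + log_sinc x"
proof -
  have "ln (2 * pi * x) = ln (2 * pi) + ln x" using assms by (simp add: ln_mult_pos)
  then show ?thesis
    using ln_Gamma_reflection_real[OF assms] ln_Gamma_plus1_real[OF assms(1)]
    by (simp add: log_sinc_def add_ac)
qed

lemma log_sinc_has_derivative:
  assumes "-1 < x" "x < 1"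
  shows "(log_sinc has_real_derivative Digamma (1 - x) - Digamma (1 + x)) (at x)"
  unfolding log_sinc_def[abs_def] using assms by (auto intro!: derivative_eq_intros)

lemma log_sinc'_has_derivative:
  assumes "-1 < x" "x < (1::real)"
  shows "((\<lambda>x. Digamma (1 - x) - Digamma (1 + x)) has_real_derivative
     - Polygamma 1 (1 - x) - Polygamma 1 (1 + x)) (at x)"
  using assms by (auto intro!: derivative_eq_intros elim!: nonpos_Ints_cases)

lemma log_sinc''_bound:
  assumes "0 \<le> x" "x \<le> (11/12::real)"
  shows "\<bar>- Polygamma 1 (1 - x) - Polygamma 1 (1 + x)\<bar> \<le> 2 * Polygamma 1 (1/12)"
  using trigamma_antimono[of "1/12" "1 - x"] trigamma_antimono[of "1/12" "1 + x"]
    trigamma_pos[of "1 - x"] trigamma_pos[of "1 + x"] assms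
  by auto

lemma log_sinc_antiderivative:
  obtains H where "\<And>x. x \<in> {0..11/12} \<Longrightarrow> (H has_real_derivative log_sinc x) (at x)"
proof
  fix x :: real assume x: "x \<in> {0..11/12}"
  \<comment> \<open>Integrating from -1/2 up to points below 23/24 makes all of [0, 11/12] interior,
    so the antiderivative has a two-sided derivative even at 0.\<close>
  have "continuous_on {-1/2..23/24} log_sinc"
    by (intro continuous_at_imp_continuous_on ballI DERIV_isCont[OF log_sinc_has_derivative]) auto
  then have "((\<lambda>t. integral {-1/2..t} log_sinc) has_real_derivative log_sinc x) (at x within {-1/2..23/24})"
    by (rule integral_has_real_derivative) (use x in auto)
  moreover have "at x within {-1/2..23/24} = at x"
    using x by (intro at_within_interior) auto
  ultimately show "((\<lambda>t. integral {-1/2..t} log_sinc) has_real_derivative log_sinc x) (at x)"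
    by simp
qed

text \<open>The composite trapezoid rule with step \<alpha>. The endpoint 0 needs no half-weight
  correction because \<open>log_sinc\<close> vanishes there. At most 1 / \<alpha> steps with error
  of order \<alpha>^3 each, divided by \<alpha>, give an error of order \<alpha>.\<close>

lemma log_sinc_sum_bound:
  assumes H: "\<And>x. x \<in> {0..11/12} \<Longrightarrow> (H has_real_derivative log_sinc x) (at x)"
    and \<alpha>: "\<alpha> > 0" and n: "real n * \<alpha> \<le> 11/12"
  shows "\<bar>(\<Sum>m=1..n. log_sinc (real m * \<alpha>)) - (H (real n * \<alpha>) - H 0) / \<alpha> - log_sinc (real n * \<alpha>) / 2\<bar>
    \<le> Polygamma 1 (1/12) * \<alpha>"
proof -
  define B where "B = Polygamma 1 (1/12 :: real)"
  have B: "B > 0" unfolding B_def by (rule trigamma_pos) simp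
  have "\<bar>\<alpha> * (\<Sum>m=1..k. log_sinc (real m * \<alpha>)) - (H (real k * \<alpha>) - H 0) - \<alpha> * log_sinc (real k * \<alpha>) / 2\<bar>
    \<le> real k * (B * \<alpha> ^ 3)" if "real k * \<alpha> \<le> 11/12" for k
    using that
  proof (induction k)
    case (Suc k)
    let ?a = "real k * \<alpha>" and ?b = "real (Suc k) * \<alpha>"
    have ab: "0 \<le> ?a" "?a \<le> ?b" "?b \<le> 11/12" "?b - ?a = \<alpha>"
      using Suc.prems \<alpha> by (auto simp: algebra_simps)
    have "\<bar>H ?b - H ?a - (?b - ?a) * (log_sinc ?a + log_sinc ?b) / 2\<bar> \<le> (2 * B) / 2 * (?b - ?a) ^ 3"
    proof (rule trapezoid_error_bound)
      fix x assume x: "x \<in> {?a..?b}"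
      have "0 \<le> x" using order_trans[of 0 ?a x] x ab(1) by (simp only: atLeastAtMost_iff)
      moreover have "x \<le> 11/12" using order_trans[of x ?b "11/12"] x ab(3) by (simp only: atLeastAtMost_iff)
      ultimately have x': "x \<in> {0..11/12}" "-1 < x" "x < 1" by auto
      show "(H has_real_derivative log_sinc x) (at x)" using H x' by blast
      show "(log_sinc has_real_derivative Digamma (1 - x) - Digamma (1 + x)) (at x)"
        using log_sinc_has_derivative x' by blast
      show "((\<lambda>x. Digamma (1 - x) - Digamma (1 + x)) has_real_derivative
          - Polygamma 1 (1 - x) - Polygamma 1 (1 + x)) (at x)"
        using log_sinc'_has_derivative x' by blast
      show "\<bar>- Polygamma 1 (1 - x) - Polygamma 1 (1 + x)\<bar> \<le> 2 * B"
        using log_sinc''_bound[of x] x' by (simp add: B_def)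
    qed (use ab in auto)
    then have 1: "\<bar>H ?b - H ?a - \<alpha> * (log_sinc ?a + log_sinc ?b) / 2\<bar> \<le> B * \<alpha> ^ 3"
      using ab by simp
    have 2: "\<bar>\<alpha> * (\<Sum>m=1..k. log_sinc (real m * \<alpha>)) - (H ?a - H 0) - \<alpha> * log_sinc ?a / 2\<bar>
      \<le> real k * (B * \<alpha> ^ 3)" using Suc.IH ab by simp
    have "\<alpha> * (\<Sum>m=1..Suc k. log_sinc (real m * \<alpha>)) - (H ?b - H 0) - \<alpha> * log_sinc ?b / 2
       = (\<alpha> * (\<Sum>m=1..k. log_sinc (real m * \<alpha>)) - (H ?a - H 0) - \<alpha> * log_sinc ?a / 2)
         - (H ?b - H ?a - \<alpha> * (log_sinc ?a + log_sinc ?b) / 2)"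
      by (simp add: field_simps)
    also have "\<bar>\<dots>\<bar> \<le> real k * (B * \<alpha> ^ 3) + B * \<alpha> ^ 3" using 1 2 by linarith
    also have "\<dots> = real (Suc k) * (B * \<alpha> ^ 3)" by (simp add: algebra_simps)
    finally show ?case .
  qed simp
  note * = this[OF n]
  define X where "X = (\<Sum>m=1..n. log_sinc (real m * \<alpha>)) - (H (real n * \<alpha>) - H 0) / \<alpha> - log_sinc (real n * \<alpha>) / 2"
  have "\<alpha> * X = \<alpha> * (\<Sum>m=1..n. log_sinc (real m * \<alpha>)) - (H (real n * \<alpha>) - H 0) - \<alpha> * log_sinc (real n * \<alpha>) / 2"
    using \<alpha> by (simp add: X_def field_simps)
  then have "\<bar>\<alpha> * X\<bar> \<le> real n * (B * \<alpha> ^ 3)" using * by simp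
  then have "\<alpha> * \<bar>X\<bar> \<le> real n * (B * \<alpha> ^ 3)" using \<alpha> by (simp add: abs_mult)
  also have "\<dots> = (real n * \<alpha>) * (\<alpha> * (B * \<alpha>))" by (simp add: power3_eq_cube)
  also have "\<dots> \<le> 1 * (\<alpha> * (B * \<alpha>))"
    using n \<alpha> B by (intro mult_right_mono) auto
  finally show ?thesis using \<alpha> unfolding X_def[symmetric] B_def[symmetric] by simp
qed

section \<open>Evaluation of ln P_n(\<alpha>) for n\<alpha> near 5/6\<close>

lemma ln_fact_stirling:
  assumes "n > 0"
  shows "\<bar>ln (fact n) - (real n * ln (real n) - real n + ln (2 * pi * real n) / 2)\<bar> \<le> 1 / (4 * real n)"
proof -
  have "fact n = real n * fact (n - 1)" using assms by (simp add: fact_reduce)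
  then have "ln (fact n) = ln (real n) + ln_Gamma (real n)"
    using assms by (simp add: ln_mult_pos ln_Gamma_real_conv_fact)
  also have "ln_Gamma (real n) = stirling_defect (real n) + (real n - 1/2) * ln (real n) - real n"
    by (simp add: stirling_defect_def)
  finally have "ln (fact n) - (real n * ln (real n) - real n + ln (2 * pi * real n) / 2)
     = stirling_defect (real n) - ln (2 * pi) / 2"
    using assms by (simp add: ln_mult_pos field_simps)
  moreover have "0 \<le> stirling_defect (real n) - ln (2 * pi) / 2"
    "stirling_defect (real n) - ln (2 * pi) / 2 \<le> 1 / (4 * real n)"
    using stirling_defect_bounds[of "real n"] assms by simp_all
  ultimately show ?thesis by linarith
qed

text \<open>The point 5/6 is a zero of ln (2 sin (pi x)), and on this interval the derivative pi cot
  (pi x) is bounded because the sine is at least sin (pi / 12).\<close>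

lemma ln_sin_pi_Lipschitz:
  assumes "x \<in> {1/12..11/12}"
  shows "\<bar>ln (2 * sin (pi * x))\<bar> \<le> pi / sin (pi / 12) * \<bar>x - 5/6\<bar>"
proof -
  have s0: "sin (pi / 12) > 0" by (intro sin_gt_zero) auto
  have s: "sin (pi / 12) \<le> sin (pi * t)" if "t \<in> {1/12..11/12}" for t
  proof (cases "t \<le> 1/2")
    case True
    then have "pi * t \<le> pi / 2" "pi / 12 \<le> pi * t" using that by auto
    then show ?thesis by (intro sin_monotone_2pi_le) auto
  next
    case False
    have "pi * (1 - t) \<le> pi / 2" "pi / 12 \<le> pi * (1 - t)"
      using that False mult_left_mono[of "1 - t" "1/2" pi] mult_left_mono[of "1/12" "1 - t" pi] by auto
    then have "sin (pi / 12) \<le> sin (pi * (1 - t))" by (intro sin_monotone_2pi_le) auto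
    also have "sin (pi * (1 - t)) = sin (pi * t)" by (simp add: right_diff_distrib sin_diff)
    finally show ?thesis .
  qed
  have "norm (ln (2 * sin (pi * x)) - ln (2 * sin (pi * (5/6)))) \<le> pi / sin (pi / 12) * norm (x - 5/6)"
  proof (rule field_differentiable_bound[of "{1/12..11/12}"])
    show "((\<lambda>x. ln (2 * sin (pi * x))) has_field_derivative pi * cos (pi * t) / sin (pi * t)) (at t within {1/12..11/12})"
      if "t \<in> {1/12..11/12}" for t
      by (rule has_field_derivative_at_within)
         (use s[OF that] s0 in \<open>auto intro!: derivative_eq_intros simp: field_simps\<close>)
    show "norm (pi * cos (pi * t) / sin (pi * t)) \<le> pi / sin (pi / 12)" if "t \<in> {1/12..11/12}" for t
    proof -
      have "norm (pi * cos (pi * t) / sin (pi * t)) = pi * \<bar>cos (pi * t)\<bar> / sin (pi * t)"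
        using s[OF that] s0 by (simp add: abs_mult)
      also have "\<dots> \<le> pi * 1 / sin (pi / 12)"
        using s[OF that] s0 by (intro frac_le mult_left_mono) auto
      finally show ?thesis by simp
    qed
  qed (use assms in auto)
  moreover have "sin (pi * (5/6)) = 1/2"
    using sin_diff[of pi "pi / 6"] by (simp add: sin_30 field_simps)
  then have "ln (2 * sin (pi * (5/6))) = 0" by simp
  ultimately show ?thesis unfolding real_norm_def by linarith
qed

lemma sinprod_eq_sum_ln:
  assumes "\<alpha> > 0" "real n * \<alpha> < 1"
  shows "ln (sinprod n \<alpha>) = (\<Sum>m=1..n. ln (2 * sin (pi * (real m * \<alpha>))))"
proof -
  have m: "0 < real m * \<alpha>" "real m * \<alpha> < 1" if "m \<in> {1..n}" for m
  proof -
    have "real m * \<alpha> \<le> real n * \<alpha>" using that assms by (intro mult_right_mono) auto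
    then show "real m * \<alpha> < 1" using assms by linarith
  qed (use that assms in auto)
  have s: "sin (pi * (real m * \<alpha>)) > 0" if "m \<in> {1..n}" for m
    using m[OF that] by (intro sin_gt_zero) auto
  have "sinprod n \<alpha> = (\<Prod>m=1..n. 2 * sin (pi * (real m * \<alpha>)))"
    unfolding sinprod_def
  proof (rule prod.cong[OF refl])
    fix m assume "m \<in> {1..n}"
    from s[OF this] show "\<bar>2 * sin (pi * real m * \<alpha>)\<bar> = 2 * sin (pi * (real m * \<alpha>))"
      by (simp add: mult.assoc)
  qed
  also have "ln \<dots> = (\<Sum>m=1..n. ln (2 * sin (pi * (real m * \<alpha>))))"
    by (rule ln_prod) (use s in force)+
  finally show ?thesis .
qed

text \<open>The singularity at 0 is logarithmic and sits in ln (2 pi x), whose antiderivative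
  extends continuously to 0 since x ln x tends to 0; the rest is the smooth
  \<open>log_sinc\<close>.\<close>

lemma ln_sin_integral_eq:
  assumes H: "\<And>x. x \<in> {0..11/12} \<Longrightarrow> (H has_real_derivative log_sinc x) (at x)"
    and c: "0 < c" "c \<le> 11/12"
  shows "((\<lambda>x. ln (2 * sin (pi * x))) has_integral (c * ln (2 * pi * c) - c + H c - H 0)) {0..c}"
proof -
  let ?W = "\<lambda>x. x * ln (2 * pi * x) - x + H x"
  have "((\<lambda>x. ln (2 * sin (pi * x))) has_integral (?W c - ?W 0)) {0..c}"
  proof (rule fundamental_theorem_of_calculus_interior)
    show "continuous_on {0..c} ?W"
    proof (intro continuous_on_add continuous_on_diff continuous_on_id)
      show "continuous_on {0..c} (\<lambda>x. x * ln (2 * pi * x))"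
      proof (rule continuous_on_eq_continuous_within[THEN iffD2], rule ballI)
        fix x assume x: "x \<in> {0..c}"
        show "continuous (at x within {0..c}) (\<lambda>x. x * ln (2 * pi * x))"
        proof (cases "x = 0")
          case True
          have "((\<lambda>x. x * ln (2 * pi * x)) \<longlongrightarrow> 0) (at_right 0)" by real_asymp
          moreover have "at 0 within {0..c} = at_right (0::real)"
            using c by (simp add: at_within_Icc_at_right)
          ultimately show ?thesis using True by (simp add: continuous_within)
        next
          case False
          then show ?thesis using x by (intro continuous_intros) auto
        qed
      qed
      show "continuous_on {0..c} H"
        by (intro continuous_at_imp_continuous_on ballI DERIV_isCont[OF H]) (use c in auto)
    qed
    show "(?W has_vector_derivative ln (2 * sin (pi * x))) (at x)" if "x \<in> {0<..<c}" for x
    proof -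
      have "(?W has_real_derivative ln (2 * pi * x) + log_sinc x) (at x)"
        using that c by (auto intro!: derivative_eq_intros H simp: field_simps)
      then show ?thesis
        using ln_sin_eq_log_sinc[of x] that c by (simp add: has_real_derivative_iff_has_vector_derivative)
    qed
  qed (use c in auto)
  then show ?thesis by simp
qed

text \<open>Each factor splits into 2 pi \<alpha> m times a sinc value. The linear parts form a
  factorial, treated by Stirling, and the sinc parts are summed by the trapezoid rule; together they
  give the integral up to c = n\<alpha>, divided by \<alpha>. Moving c to 5/6 is cheap because the
  integrand vanishes there.\<close>

lemma sinprod_initial_asymptotics:
  "\<exists>C\<ge>0. \<forall>\<alpha> n. 0 < \<alpha> \<longrightarrow> \<alpha> \<le> 1/20 \<longrightarrow> 5/6 - 4 * \<alpha> \<le> real n * \<alpha> \<longrightarrow> real n * \<alpha> \<le> 5/6 \<longrightarrow>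
     \<bar>ln (sinprod n \<alpha>) - vol41 / (4 * pi) / \<alpha> - ln (1 / \<alpha>) / 2\<bar> \<le> C * \<alpha>"
proof -
  obtain H where H: "\<And>x. x \<in> {0..11/12} \<Longrightarrow> (H has_real_derivative log_sinc x) (at x)"
    using log_sinc_antiderivative by blast
  define W where "W = (\<lambda>c. c * ln (2 * pi * c) - c + H c - H 0)"
  define F where "F = pi / sin (pi / 12)"
  define P where "P = Polygamma 1 (1/12 :: real)"
  have F: "F \<ge> 0" unfolding F_def by (intro divide_nonneg_nonneg sin_ge_zero) auto
  have P: "P > 0" unfolding P_def by (rule trigamma_pos) simp
  have V: "vol41 / (4 * pi) = W (5/6)"
    using integral_unique[OF ln_sin_integral_eq[OF H, of "5/6"]] by (simp add: vol41_def W_def)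
  have W': "(W has_real_derivative ln (2 * sin (pi * x))) (at x)" if "x \<in> {7/12..5/6}" for x
    unfolding W_def using that ln_sin_eq_log_sinc[of x]
    by (auto intro!: derivative_eq_intros H simp: field_simps)
  show ?thesis
  proof (intro exI[of _ "1/2 + P + 18 * F"] conjI allI impI)
    show "0 \<le> 1/2 + P + 18 * F" using F P by simp
    fix \<alpha> :: real and n :: nat
    assume \<alpha>: "0 < \<alpha>" "\<alpha> \<le> 1/20" and n: "5/6 - 4 * \<alpha> \<le> real n * \<alpha>" "real n * \<alpha> \<le> 5/6"
    define c where "c = real n * \<alpha>"
    have c: "7/12 \<le> c" "c \<le> 5/6" "\<bar>c - 5/6\<bar> \<le> 4 * \<alpha>" using n \<alpha> by (auto simp: c_def)
    have n0: "n > 0" using c by (cases n) (auto simp: c_def)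
    have nc: "real n = c / \<alpha>" using \<alpha> by (simp add: c_def)
    have mc: "0 < real m * \<alpha> \<and> real m * \<alpha> < 1" if "m \<in> {1..n}" for m
    proof -
      have "real m * \<alpha> \<le> c" using that \<alpha> unfolding c_def by (intro mult_right_mono) auto
      then show ?thesis using c that \<alpha> by auto
    qed
    have "ln (sinprod n \<alpha>) = (\<Sum>m=1..n. ln (2 * sin (pi * (real m * \<alpha>))))"
      using sinprod_eq_sum_ln[of \<alpha> n] \<alpha> c by (simp add: c_def)
    also have "\<dots> = (\<Sum>m=1..n. ln (2 * pi * \<alpha>) + ln (real m) + log_sinc (real m * \<alpha>))"
    proof (rule sum.cong[OF refl])
      fix m assume m: "m \<in> {1..n}"
      have "ln (2 * pi * (real m * \<alpha>)) = ln ((2 * pi * \<alpha>) * real m)" by (simp add: mult_ac)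
      also have "\<dots> = ln (2 * pi * \<alpha>) + ln (real m)" using \<alpha> m by (intro ln_mult_pos) auto
      finally show "ln (2 * sin (pi * (real m * \<alpha>))) = ln (2 * pi * \<alpha>) + ln (real m) + log_sinc (real m * \<alpha>)"
        using ln_sin_eq_log_sinc mc[OF m] by simp
    qed
    also have "\<dots> = real n * ln (2 * pi * \<alpha>) + ln (fact n) + (\<Sum>m=1..n. log_sinc (real m * \<alpha>))"
    proof -
      have "ln (fact n) = ln (\<Prod>m=1..n. real m)" by (simp add: fact_prod)
      also have "\<dots> = (\<Sum>m=1..n. ln (real m))" by (rule ln_prod) auto
      finally show ?thesis by (simp only: sum.distrib sum_constant card_atLeastAtMost) simp
    qed
    finally have eq: "ln (sinprod n \<alpha>) = \<dots>" .
    define e1 where "e1 = ln (fact n) - (real n * ln (real n) - real n + ln (2 * pi * real n) / 2)"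
    define e2 where "e2 = (\<Sum>m=1..n. log_sinc (real m * \<alpha>)) - (H c - H 0) / \<alpha> - log_sinc c / 2"
    have "\<bar>e1\<bar> \<le> 1 / (4 * real n)" unfolding e1_def by (rule ln_fact_stirling[OF n0])
    also have "\<dots> = \<alpha> * (1 / (4 * c))" by (simp add: nc)
    also have "\<dots> \<le> \<alpha> * (1 / 2)" using c \<alpha> by (intro mult_left_mono) (auto simp: field_simps)
    finally have e1: "\<bar>e1\<bar> \<le> \<alpha> / 2" by simp
    have e2: "\<bar>e2\<bar> \<le> P * \<alpha>"
      using log_sinc_sum_bound[OF H \<alpha>(1), of n] c unfolding e2_def P_def c_def by simp
    have ln_n: "ln (real n) = ln c - ln \<alpha>" using \<alpha> c by (simp add: nc ln_div)
    \<comment> \<open>The half logarithm from Stirling, ln (2 pi n) / 2 with n = c / \<alpha>, joins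
      the endpoint term log_sinc c / 2 to form ln (2 sin (pi c)) / 2 + ln (1 / \<alpha>) /
      2.\<close>
    have "ln (sinprod n \<alpha>) = W c / \<alpha> + ln (2 * sin (pi * c)) / 2 + ln (1 / \<alpha>) / 2 + e1 + e2"
    proof -
      have l: "ln (2 * pi * \<alpha>) = ln (2 * pi) + ln \<alpha>" "ln (2 * pi * real n) = ln (2 * pi) + ln c - ln \<alpha>"
        "ln (2 * pi * c) = ln (2 * pi) + ln c" "ln (1 / \<alpha>) = - ln \<alpha>"
        using \<alpha> c n0 ln_n by (simp_all add: ln_mult_pos ln_div)
      have f: "ln (2 * sin (pi * c)) = ln (2 * pi) + ln c + log_sinc c"
        using ln_sin_eq_log_sinc[of c] c l by simp
      have "W c / \<alpha> = real n * ln (2 * pi) + real n * ln c - real n + (H c - H 0) / \<alpha>"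
        unfolding W_def l using \<alpha> by (simp add: nc field_simps)
      moreover have "real n * ln (2 * pi * \<alpha>) = real n * ln (2 * pi) + real n * ln \<alpha>"
        "real n * ln (real n) = real n * ln c - real n * ln \<alpha>"
        unfolding l(1) ln_n by (simp_all only: distrib_left right_diff_distrib)
      ultimately show ?thesis
        using eq e1_def e2_def l(2,4) f by linarith
    qed
    moreover have "\<bar>ln (2 * sin (pi * c))\<bar> \<le> F * (4 * \<alpha>)"
    proof -
      have "\<bar>ln (2 * sin (pi * c))\<bar> \<le> F * \<bar>c - 5/6\<bar>"
        unfolding F_def using c by (intro ln_sin_pi_Lipschitz) auto
      also have "\<dots> \<le> F * (4 * \<alpha>)" using c F by (intro mult_left_mono) auto
      finally show ?thesis .
    qed
    \<comment> \<open>W is stationary at 5/6, so a displacement of at most 4\<alpha> changes it only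
      by order \<alpha>^2, which survives the division by \<alpha>.\<close>
    moreover have "\<bar>W c / \<alpha> - W (5/6) / \<alpha>\<bar> \<le> 16 * F * \<alpha>"
    proof -
      have "norm (W c - W (5/6)) \<le> F * (4 * \<alpha>) * norm (c - 5/6)"
      proof (rule field_differentiable_bound[of "{c..5/6}"])
        show "(W has_field_derivative ln (2 * sin (pi * x))) (at x within {c..5/6})" if "x \<in> {c..5/6}" for x
          by (rule has_field_derivative_at_within, rule W') (use that c in auto)
        show "norm (ln (2 * sin (pi * x))) \<le> F * (4 * \<alpha>)" if "x \<in> {c..5/6}" for x
        proof -
          have "\<bar>ln (2 * sin (pi * x))\<bar> \<le> F * \<bar>x - 5/6\<bar>"
            unfolding F_def using c that by (intro ln_sin_pi_Lipschitz) auto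
          also have "\<dots> \<le> F * (4 * \<alpha>)" using c F that by (intro mult_left_mono) auto
          finally show ?thesis by simp
        qed
      qed (use c in auto)
      also have "\<dots> \<le> F * (4 * \<alpha>) * (4 * \<alpha>)" using c F \<alpha> by (intro mult_left_mono) auto
      finally have "\<bar>W c - W (5/6)\<bar> / \<alpha> \<le> F * (4 * \<alpha>) * (4 * \<alpha>) / \<alpha>"
        using \<alpha> by (intro divide_right_mono) auto
      then show ?thesis using \<alpha> by (simp add: diff_divide_distrib[symmetric])
    qed
    ultimately have "\<bar>ln (sinprod n \<alpha>) - W (5/6) / \<alpha> - ln (1 / \<alpha>) / 2\<bar>
        \<le> 16 * F * \<alpha> + F * (4 * \<alpha>) / 2 + \<alpha> / 2 + P * \<alpha>"
      using e1 e2 by linarith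
    also have "\<dots> = (1/2 + P + 18 * F) * \<alpha>" by (simp add: algebra_simps)
    finally show "\<bar>ln (sinprod n \<alpha>) - vol41 / (4 * pi) / \<alpha> - ln (1 / \<alpha>) / 2\<bar> \<le> (1/2 + P + 18 * F) * \<alpha>"
      unfolding V .
  qed
qed

text \<open>Small \<alpha> is handled by comparison with an initial segment of known size. For
  \<alpha> above 1/20 a bounded error is already of order \<alpha>, so the crude bound
  suffices.\<close>

lemma renormalization_asymptotics:
  "\<exists>C\<ge>0. \<forall>\<alpha> N M. 0 < \<alpha> \<longrightarrow> \<alpha> < 1 \<longrightarrow> \<alpha> \<notin> \<rat> \<longrightarrow> - (5/6) * \<alpha> \<le> real N * \<alpha> - real M \<longrightarrow>
     5/6 - 3 * \<alpha> \<le> real N * \<alpha> - real M \<longrightarrow> real N * \<alpha> - real M \<le> 5/6 \<longrightarrow>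
     \<bar>ln (sinprod N \<alpha>) - ln (sinprod M (1 / \<alpha>)) - vol41 / (4 * pi) / \<alpha> - ln (1 / \<alpha>) / 2\<bar> \<le> C * \<alpha>"
proof -
  obtain C0 where C0: "C0 \<ge> 0" "\<And>\<alpha> n. 0 < \<alpha> \<Longrightarrow> \<alpha> \<le> 1/20 \<Longrightarrow> 5/6 - 4 * \<alpha> \<le> real n * \<alpha> \<Longrightarrow>
     real n * \<alpha> \<le> 5/6 \<Longrightarrow> \<bar>ln (sinprod n \<alpha>) - vol41 / (4 * pi) / \<alpha> - ln (1 / \<alpha>) / 2\<bar> \<le> C0 * \<alpha>"
    using sinprod_initial_asymptotics by blast
  define F where "F = pi / sin (pi / 12)"
  define P where "P = Polygamma 1 (1/6 :: real)"
  define V where "V = vol41 / (4 * pi)"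
  have F: "F \<ge> 0" unfolding F_def by (intro divide_nonneg_nonneg sin_ge_zero) auto
  have P: "P > 0" unfolding P_def by (rule trigamma_pos) simp
  \<comment> \<open>D bounds everything when \<alpha> > 1/20: 1600 is 4 times 20 squared, and the
    other terms bound V / \<alpha> and ln (1 / \<alpha>) / 2.\<close>
  define D where "D = ln 2 + 1600 * P + 20 * \<bar>V\<bar> + ln 20 / 2"
  have D: "D \<ge> 0" using P by (simp add: D_def)
  show ?thesis
  proof (intro exI[of _ "C0 + 4 * F + 20 * D"] conjI allI impI)
    show "0 \<le> C0 + 4 * F + 20 * D" using C0 F D by simp
    fix \<alpha> :: real and N M :: nat
    assume \<alpha>: "0 < \<alpha>" "\<alpha> < 1" "\<alpha> \<notin> \<rat>"
      and t: "- (5/6) * \<alpha> \<le> real N * \<alpha> - real M" "5/6 - 3 * \<alpha> \<le> real N * \<alpha> - real M"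
        "real N * \<alpha> - real M \<le> 5/6"
    define \<Phi> where "\<Phi> = ln (sinprod N \<alpha>) - ln (sinprod M (1 / \<alpha>))"
    have "\<bar>\<Phi> - V / \<alpha> - ln (1 / \<alpha>) / 2\<bar> \<le> (C0 + 4 * F + 20 * D) * \<alpha>"
    proof (cases "\<alpha> \<le> 1/20")
      case True
      define \<theta> where "\<theta> = real N * \<alpha> - real M"
      have \<theta>: "\<theta> > 0" "5/6 - 3 * \<alpha> \<le> \<theta>" "\<theta> \<le> 5/6" using t True by (auto simp: \<theta>_def)
      \<comment> \<open>The multiple n\<alpha> lies at most \<alpha> below \<theta>, hence within
        4\<alpha> of 5/6. With \<alpha> \<le> 1/20 the points n\<alpha> - \<alpha> and n\<alpha> +
        \<alpha> stay in the concave half of the strip.\<close>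
      define n where "n = nat \<lfloor>\<theta> / \<alpha>\<rfloor>"
      have "real n \<le> \<theta> / \<alpha>" "\<theta> / \<alpha> \<le> real n + 1"
        using \<theta> \<alpha> by (simp_all add: n_def)
      then have n: "real n * \<alpha> \<le> \<theta>" "\<theta> \<le> real n * \<alpha> + \<alpha>"
        using \<alpha> by (simp_all add: field_simps)
      have Lip: "\<bar>ln (2 * sin (pi * x))\<bar> \<le> 4 * F * \<alpha>" if "x \<in> {1/12..11/12}" "\<bar>x - 5/6\<bar> \<le> 4 * \<alpha>" for x
      proof -
        have "\<bar>ln (2 * sin (pi * x))\<bar> \<le> F * \<bar>x - 5/6\<bar>"
          unfolding F_def using that by (intro ln_sin_pi_Lipschitz) auto
        also have "\<dots> \<le> F * (4 * \<alpha>)" using that F by (intro mult_left_mono) auto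
        finally show ?thesis by simp
      qed
      have "\<bar>\<Phi> - ln (sinprod n \<alpha>)\<bar> \<le> 4 * F * \<alpha>"
        unfolding \<Phi>_def
      proof (rule renormalization_compare[OF \<alpha>])
        show "\<bar>ln (2 * sin (pi * (real n * \<alpha>)))\<bar> \<le> 4 * F * \<alpha>"
          by (rule Lip) (use n \<theta> \<alpha> True in auto)
        show "\<bar>ln (2 * sin (pi * (real n * \<alpha> + \<alpha>)))\<bar> \<le> 4 * F * \<alpha>"
          by (rule Lip) (use n \<theta> \<alpha> True in \<open>auto simp: abs_le_iff\<close>)
      qed (use n \<theta> \<alpha> True in \<open>auto simp: \<theta>_def\<close>)
      moreover have "\<bar>ln (sinprod n \<alpha>) - V / \<alpha> - ln (1 / \<alpha>) / 2\<bar> \<le> C0 * \<alpha>"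
        unfolding V_def by (rule C0(2)) (use n \<theta> \<alpha> True in auto)
      ultimately have "\<bar>\<Phi> - V / \<alpha> - ln (1 / \<alpha>) / 2\<bar> \<le> 4 * F * \<alpha> + C0 * \<alpha>" by linarith
      also have "\<dots> \<le> (C0 + 4 * F + 20 * D) * \<alpha>" using D \<alpha> by (simp add: algebra_simps)
      finally show ?thesis .
    next
      case False
      have "\<bar>\<Phi>\<bar> \<le> ln 2 + 4 * P / \<alpha>\<^sup>2"
        unfolding \<Phi>_def P_def using t \<alpha> by (intro renormalization_bound) auto
      moreover have "4 * P / \<alpha>\<^sup>2 \<le> 4 * P / (1/20)\<^sup>2"
        using P False by (intro divide_left_mono power_mono mult_pos_pos) auto
      then have "4 * P / \<alpha>\<^sup>2 \<le> 1600 * P" by (simp add: power2_eq_square)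
      moreover have "\<bar>V / \<alpha>\<bar> \<le> 20 * \<bar>V\<bar>"
      proof -
        have "\<bar>V / \<alpha>\<bar> = \<bar>V\<bar> * (1 / \<alpha>)" using \<alpha> by simp
        also have "\<dots> \<le> \<bar>V\<bar> * 20" using False \<alpha> by (intro mult_left_mono) (auto simp: field_simps)
        finally show ?thesis by simp
      qed
      moreover have "0 \<le> ln (1 / \<alpha>)"
        using \<alpha> by (intro ln_ge_zero) (simp add: field_simps)
      moreover have "ln (1 / \<alpha>) \<le> ln 20"
        using False \<alpha> by (intro ln_mono) (simp_all add: field_simps)
      ultimately have "\<bar>\<Phi> - V / \<alpha> - ln (1 / \<alpha>) / 2\<bar> \<le> D" unfolding D_def by linarith
      also have "D * 1 \<le> D * (20 * \<alpha>)" using D False by (intro mult_left_mono) auto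
      then have "D \<le> 20 * D * \<alpha>" by simp
      also have "\<dots> \<le> (C0 + 4 * F + 20 * D) * \<alpha>" using C0(1) F \<alpha> by (simp add: algebra_simps)
      finally show ?thesis .
    qed
    then show "\<bar>ln (sinprod N \<alpha>) - ln (sinprod M (1 / \<alpha>)) - vol41 / (4 * pi) / \<alpha> - ln (1 / \<alpha>) / 2\<bar>
        \<le> (C0 + 4 * F + 20 * D) * \<alpha>"
      by (simp add: \<Phi>_def V_def)
  qed
qed

section \<open>Continued fractions\<close>

lemma inverse_frac_irrational:
  fixes x :: real
  assumes "x \<notin> \<rat>"
  shows "0 < frac x" "frac x < 1" "frac x \<notin> \<rat>" "1 / frac x \<notin> \<rat>"
proof -
  show "frac x < 1" by (rule frac_lt_1)
  have "x = of_int \<lfloor>x\<rfloor> + frac x" by (simp add: frac_def)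
  then show 1: "frac x \<notin> \<rat>" using assms by (metis Rats_add Rats_of_int)
  then have "frac x \<noteq> 0" by (metis Rats_0)
  then show "0 < frac x" using frac_ge_0[of x] by linarith
  show "1 / frac x \<notin> \<rat>"
  proof
    assume "1 / frac x \<in> \<rat>"
    then have "inverse (1 / frac x) \<in> \<rat>" by (rule Rats_inverse)
    then show False using 1 by simp
  qed
qed

lemma cf_rest_Suc': "cf_rest x (Suc k) = cf_rest (1 / frac x) k"
  by (induction k) auto

lemma cf_a_Suc: "cf_a x (Suc k) = cf_a (1 / frac x) k"
  by (simp only: cf_a_def cf_rest_Suc')

lemma cf_a_Suc_pos:
  assumes "x \<notin> \<rat>"
  shows "cf_a x (Suc k) \<ge> 1"
  using assms
proof (induction k arbitrary: x)
  case 0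
  have "1 / frac x \<ge> 1" using inverse_frac_irrational[OF 0] by simp
  then show ?case unfolding cf_a_Suc by (simp add: cf_a_def le_floor_iff)
next
  case (Suc k)
  show ?case using Suc.IH[OF inverse_frac_irrational(4)[OF Suc.prems]] by (simp only: cf_a_Suc[of x])
qed

text \<open>The denominators are continuants, which can be expanded at the first partial quotient as
  well as at the last. The case split encodes the convention that the denominator of index -1 is 0,
  since subtraction on naturals would give index 0.\<close>

lemma cf_q_Suc_rec:
  "cf_q x (Suc l) = cf_a x 1 * cf_q (1 / frac x) l
     + (if l = 0 then 0 else cf_q (1 / frac (1 / frac x)) (l - 1))"
proof (induction l rule: induct_nat_012)
  case 0
  show ?case by simp
next
  case 1
  show ?case by (simp add: cf_a_Suc numeral_2_eq_2)
next
  case (ge2 n)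
  have a: "cf_a x (n + 3) = cf_a (1 / frac x) (n + 2)"
    "cf_a (1 / frac x) (n + 2) = cf_a (1 / frac (1 / frac x)) (n + 1)"
    by (simp_all add: cf_a_Suc numeral_2_eq_2 numeral_3_eq_3)
  have "cf_q x (Suc (Suc (Suc n))) = cf_a x (n + 3) * cf_q x (Suc (Suc n)) + cf_q x (Suc n)"
    by (simp add: numeral_3_eq_3)
  also have "\<dots> = cf_a x 1 * cf_q (1 / frac x) (Suc (Suc n))
     + (cf_a x (n + 3) * cf_q (1 / frac (1 / frac x)) n
        + (if n = 0 then 0 else cf_q (1 / frac (1 / frac x)) (n - 1)))"
    unfolding ge2 by (simp add: a algebra_simps)
  also have "cf_a x (n + 3) * cf_q (1 / frac (1 / frac x)) n
        + (if n = 0 then 0 else cf_q (1 / frac (1 / frac x)) (n - 1)) = cf_q (1 / frac (1 / frac x)) (Suc n)"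
    unfolding a by (cases n) auto
  finally show ?case by simp
qed

section \<open>The numbers N* under the Gauss map\<close>

definition cf_b :: "real \<Rightarrow> nat \<Rightarrow> int" where
  "cf_b x k = \<lfloor>(5/6) * real_of_int (cf_a x (k+1))\<rfloor>"

lemma cf_b_nonneg: "x \<notin> \<rat> \<Longrightarrow> cf_b x k \<ge> 0"
  using cf_a_Suc_pos[of x k] by (simp add: cf_b_def)

lemma cf_b_Suc: "cf_b x (Suc k) = cf_b (1 / frac x) k"
  by (simp add: cf_b_def cf_a_Suc[of x "Suc k"])

lemma cf_q_pos: "x \<notin> \<rat> \<Longrightarrow> cf_q x k \<ge> 1"
proof (induction k rule: induct_nat_012)
  case 1
  then show ?case using cf_a_Suc_pos[of x 0] by simp
next
  case (ge2 n)
  have "cf_a x (n + 2) * cf_q x (Suc n) \<ge> 0"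
    using cf_a_Suc_pos[of x "Suc n"] ge2 by (intro mult_nonneg_nonneg) auto
  then show ?case using ge2 by simp
qed simp

lemma int_Nstar:
  assumes "x \<notin> \<rat>"
  shows "int (Nstar x K) = (\<Sum>k<K. cf_b x k * cf_q x k)"
proof -
  have "(\<Sum>k<K. cf_b x k * cf_q x k) \<ge> 0"
    using cf_b_nonneg[OF assms] cf_q_pos[OF assms] by (intro sum_nonneg mult_nonneg_nonneg) (auto intro: order_trans[of 0 1])
  then show ?thesis by (simp add: Nstar_def cf_b_def)
qed

text \<open>The digits of N* shift along the Gauss map, so the expansion of the denominators at the
  first partial quotient carries over to the digit sums.\<close>

lemma Nstar_rec:
  assumes "x \<notin> \<rat>"
  shows "int (Nstar x (Suc 0)) = cf_b x 0"
    and "int (Nstar x (Suc (Suc K))) = cf_b x 0 + cf_a x 1 * int (Nstar (1 / frac x) (Suc K))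
           + int (Nstar (1 / frac (1 / frac x)) K)"
proof -
  let ?y = "1 / frac x" and ?z = "1 / frac (1 / frac x)"
  have y: "?y \<notin> \<rat>" and z: "?z \<notin> \<rat>"
    using inverse_frac_irrational(4) assms by blast+
  show "int (Nstar x (Suc 0)) = cf_b x 0" by (simp add: int_Nstar[OF assms])
  have "int (Nstar x (Suc (Suc K))) = cf_b x 0 + (\<Sum>l<Suc K. cf_b ?y l * cf_q x (Suc l))"
    unfolding int_Nstar[OF assms] by (subst sum.lessThan_Suc_shift) (simp add: cf_b_Suc)
  also have "(\<Sum>l<Suc K. cf_b ?y l * cf_q x (Suc l))
      = cf_a x 1 * (\<Sum>l<Suc K. cf_b ?y l * cf_q ?y l)
        + (\<Sum>l<Suc K. cf_b ?y l * (if l = 0 then 0 else cf_q ?z (l - 1)))"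
    unfolding cf_q_Suc_rec sum_distrib_left sum.distrib[symmetric]
    by (intro sum.cong refl) (simp add: algebra_simps)
  also have "(\<Sum>l<Suc K. cf_b ?y l * (if l = 0 then 0 else cf_q ?z (l - 1))) = (\<Sum>l<K. cf_b ?z l * cf_q ?z l)"
    by (subst sum.lessThan_Suc_shift) (simp add: cf_b_Suc)
  finally show "int (Nstar x (Suc (Suc K))) = cf_b x 0 + cf_a x 1 * int (Nstar ?y (Suc K)) + int (Nstar ?z K)"
    using int_Nstar[OF y] int_Nstar[OF z] by simp
qed

text \<open>If t is the strip coordinate for the next point y of the Gauss orbit and b the leading
  digit, the coordinate for x is exactly (b - t) times \<open>frac x\<close>. The bounds t \<le> 5/6
  and t \<ge> -(5/6) \<open>frac y\<close> reproduce each other under this map, which is why the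
  lower bound scales with the fractional part.\<close>

lemma Nstar_renormalization_bounds:
  fixes x :: real
  assumes "x \<notin> \<rat>"
  shows "- (5/6) * frac x \<le> real (Nstar x (Suc K)) * frac x - real (Nstar (1 / frac x) K) \<and>
    5/6 - 3 * frac x \<le> real (Nstar x (Suc K)) * frac x - real (Nstar (1 / frac x) K) \<and>
    real (Nstar x (Suc K)) * frac x - real (Nstar (1 / frac x) K) \<le> 5/6"
  using assms
proof (induction K arbitrary: x)
  case 0
  define \<alpha> where "\<alpha> = frac x"
  have \<alpha>: "0 < \<alpha>" "\<alpha> < 1" using inverse_frac_irrational[OF 0] by (auto simp: \<alpha>_def)
  define b where "b = real_of_int (cf_b x 0)"
  have "b = real_of_int \<lfloor>5/6 * real_of_int \<lfloor>1 / \<alpha>\<rfloor>\<rfloor>"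
    by (simp add: b_def cf_b_def cf_a_def \<alpha>_def)
  moreover have "0 \<le> b" using cf_b_nonneg[OF 0, of 0] by (simp add: b_def)
  \<comment> \<open>The inner floor costs at most 5/6 and the outer floor at most 1, in total less
    than 2.\<close>
  ultimately have b: "0 \<le> b" "b \<le> 5/6 * (1 / \<alpha>)" "5/6 * (1 / \<alpha>) - 2 \<le> b"
    using floor_correct[of "1 / \<alpha>"] floor_correct[of "5/6 * real_of_int \<lfloor>1 / \<alpha>\<rfloor>"]
    by linarith+
  have Nb: "real (Nstar x (Suc 0)) = b"
    using Nstar_rec(1)[OF 0] unfolding b_def by (metis of_int_of_nat_eq)
  have "0 \<le> b * \<alpha>" using b \<alpha> by simp
  moreover have "b * \<alpha> \<le> 5/6 * (1 / \<alpha>) * \<alpha>" using b(2) by (rule mult_right_mono) (use \<alpha> in simp)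
  moreover have "(5/6 * (1 / \<alpha>) - 2) * \<alpha> \<le> b * \<alpha>" using b(3) by (rule mult_right_mono) (use \<alpha> in simp)
  moreover have "5/6 * (1 / \<alpha>) * \<alpha> = 5/6" "(5/6 * (1 / \<alpha>) - 2) * \<alpha> = 5/6 - 2 * \<alpha>"
    using \<alpha> by (simp_all add: left_diff_distrib)
  ultimately have "- (5/6) * \<alpha> \<le> b * \<alpha> \<and> 5/6 - 3 * \<alpha> \<le> b * \<alpha> \<and> b * \<alpha> \<le> 5/6"
    using \<alpha> by linarith
  moreover have "real (Nstar (1 / frac x) 0) = 0" by (simp add: Nstar_def)
  ultimately show ?case
    unfolding \<alpha>_def[symmetric] Nb by simp
next
  case (Suc K)
  define \<alpha> where "\<alpha> = frac x"
  define y where "y = 1 / frac x"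
  define z where "z = 1 / frac y"
  have \<alpha>: "0 < \<alpha>" "\<alpha> < 1" and y: "y \<notin> \<rat>"
    using inverse_frac_irrational[OF Suc.prems] by (auto simp: \<alpha>_def y_def)
  have y\<alpha>: "y * \<alpha> = 1" using \<alpha> by (simp add: y_def \<alpha>_def)
  define t where "t = real (Nstar y (Suc K)) * frac y - real (Nstar z K)"
  have IH: "- (5/6) * frac y \<le> t" "t \<le> 5/6"
    using Suc.IH[OF y] by (auto simp: t_def z_def)
  define b where "b = real_of_int (cf_b x 0)"
  have a: "real_of_int (cf_a x (Suc 0)) = y - frac y" by (simp add: cf_a_def y_def frac_def)
  have fy: "real_of_int \<lfloor>y\<rfloor> = y - frac y" "frac y < 1" "frac y \<ge> 0"
    by (simp_all add: frac_lt_1) (simp add: frac_def)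
  have "b = real_of_int \<lfloor>5/6 * (y - frac y)\<rfloor>"
    unfolding fy(1)[symmetric] by (simp add: b_def cf_b_def cf_a_def y_def)
  moreover have "0 \<le> b" using cf_b_nonneg[OF Suc.prems, of 0] by (simp add: b_def)
  ultimately have b: "0 \<le> b" "b \<le> 5/6 * (y - frac y)" "5/6 * (y - frac y) - 1 \<le> b"
    using floor_correct[of "5/6 * (y - frac y)"] by linarith+
  have N: "real (Nstar x (Suc (Suc K))) = b + (y - frac y) * real (Nstar y (Suc K)) + real (Nstar z K)"
    using arg_cong[OF Nstar_rec(2)[OF Suc.prems, of K], of real_of_int]
      a unfolding b_def y_def z_def by simp
  have "real (Nstar x (Suc (Suc K))) * \<alpha> - real (Nstar y (Suc K))
      = (b - t) * \<alpha> + (y * \<alpha>) * real (Nstar y (Suc K)) - real (Nstar y (Suc K))"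
    unfolding N t_def by (simp add: algebra_simps)
  then have eq: "real (Nstar x (Suc (Suc K))) * \<alpha> - real (Nstar y (Suc K)) = (b - t) * \<alpha>"
    by (simp add: y\<alpha>)
  \<comment> \<open>In the upper bound the term (5/6) \<open>frac y\<close> missing from b is
    exactly what - t can contribute, so nothing is lost. The 3 absorbs 5/6 from
    \<open>frac y\<close>, 1 from the floor and 5/6 from t.\<close>
  have bt: "- (5/6) \<le> b - t" "b - t \<le> 5/6 * y" "5/6 * y - 3 \<le> b - t"
    using IH b fy(2,3) by (simp_all add: algebra_simps)
  have "- (5/6) * \<alpha> \<le> (b - t) * \<alpha>" "(b - t) * \<alpha> \<le> 5/6 * y * \<alpha>" "(5/6 * y - 3) * \<alpha> \<le> (b - t) * \<alpha>"
    using bt[THEN mult_right_mono, of \<alpha>] \<alpha> by auto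
  then show ?case
    unfolding y_def[symmetric] unfolding \<alpha>_def[symmetric] eq using y\<alpha> by (simp add: left_diff_distrib mult.assoc)
qed

section \<open>Summation along the Gauss orbit\<close>

lemma sinprod_frac: "sinprod N (frac x) = sinprod N x"
  unfolding sinprod_def
proof (rule prod.cong[OF refl])
  fix n
  have e: "pi * real n * x = pi * (of_int (int n * \<lfloor>x\<rfloor>) + real n * frac x)"
    by (simp add: frac_def algebra_simps)
  have "\<bar>sin (pi * real n * x)\<bar> = \<bar>sin (pi * (real n * frac x))\<bar>"
    unfolding e by (rule abs_sin_pi_add_int)
  then show "\<bar>2 * sin (pi * real n * frac x)\<bar> = \<bar>2 * sin (pi * real n * x)\<bar>"
    by (simp add: abs_mult mult.assoc)
qed

text \<open>Induction on K along the Gauss orbit: one renormalization step passes from x with K + 1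
  digits to y = 1 / \<open>frac x\<close> with K digits. It costs C / a_1, and replacing y by its
  integer part a_1 in the main terms costs a multiple of 1 / a_2.\<close>

lemma sinprod_Nstar_asymptotics:
  "\<exists>D\<ge>0. \<forall>x K. x \<notin> \<rat> \<longrightarrow>
     \<bar>ln (sinprod (Nstar x K) x) - vol41 / (4 * pi) * (\<Sum>k=1..K. real_of_int (cf_a x k))
        - 1/2 * (\<Sum>k=1..K. ln (real_of_int (cf_a x k)))\<bar>
     \<le> D * (\<Sum>k=1..K. 1 / real_of_int (cf_a x k) + 1 / real_of_int (cf_a x (k+1)))"
proof -
  obtain C where C: "C \<ge> 0" "\<And>\<alpha> N M. 0 < \<alpha> \<Longrightarrow> \<alpha> < 1 \<Longrightarrow> \<alpha> \<notin> \<rat> \<Longrightarrow> - (5/6) * \<alpha> \<le> real N * \<alpha> - real M \<Longrightarrow>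
     5/6 - 3 * \<alpha> \<le> real N * \<alpha> - real M \<Longrightarrow> real N * \<alpha> - real M \<le> 5/6 \<Longrightarrow>
     \<bar>ln (sinprod N \<alpha>) - ln (sinprod M (1 / \<alpha>)) - vol41 / (4 * pi) / \<alpha> - ln (1 / \<alpha>) / 2\<bar> \<le> C * \<alpha>"
    using renormalization_asymptotics by blast
  define V where "V = vol41 / (4 * pi)"
  define D where "D = C + \<bar>V\<bar> + 1"
  have D: "D \<ge> 0" using C by (simp add: D_def)
  define S where "S = (\<lambda>x K. ln (sinprod (Nstar x K) x) - V * (\<Sum>k=1..K. real_of_int (cf_a x k))
        - 1/2 * (\<Sum>k=1..K. ln (real_of_int (cf_a x k))))"
  have "\<bar>S x K\<bar> \<le> D * (\<Sum>k=1..K. 1 / real_of_int (cf_a x k) + 1 / real_of_int (cf_a x (k+1)))"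
    if "x \<notin> \<rat>" for x K
    using that
  proof (induction K arbitrary: x)
    case 0
    then show ?case by (simp add: S_def Nstar_def sinprod_def)
  next
    case (Suc K)
    define \<alpha> where "\<alpha> = frac x"
    define y where "y = 1 / frac x"
    have \<alpha>: "0 < \<alpha>" "\<alpha> < 1" "\<alpha> \<notin> \<rat>" and y: "y \<notin> \<rat>"
      using inverse_frac_irrational[OF Suc.prems] by (auto simp: \<alpha>_def y_def)
    define a where "a = real_of_int (cf_a x 1)"
    define a' where "a' = real_of_int (cf_a x 2)"
    have a1: "a \<ge> 1" "a' \<ge> 1"
      using cf_a_Suc_pos[OF Suc.prems, of 0] cf_a_Suc_pos[OF Suc.prems, of 1]
      by (simp_all add: a_def a'_def numeral_2_eq_2)
    have y_eq: "y = a + frac y" by (simp add: a_def cf_a_def y_def frac_def)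
    have fy: "0 < frac y" "frac y \<le> 1 / a'"
    proof -
      show f: "0 < frac y" using inverse_frac_irrational[OF y] by simp
      have "a' = real_of_int \<lfloor>1 / frac y\<rfloor>" by (simp add: a'_def cf_a_def numeral_2_eq_2 y_def)
      then have "a' \<le> 1 / frac y" by simp
      then show "frac y \<le> 1 / a'" using f a1 by (simp add: field_simps)
    qed
    have \<alpha>y: "\<alpha> = 1 / y" "1 / \<alpha> = y" by (simp_all add: \<alpha>_def y_def)
    have ay: "a \<le> y" "0 < a" using y_eq fy(1) a1 by linarith+
    have \<alpha>a: "\<alpha> \<le> 1 / a" unfolding \<alpha>y(1) using ay by (intro divide_left_mono) auto
    \<comment> \<open>Stated for an arbitrary summand g so that it serves both main sums and the
      error sum.\<close>
    have shift: "(\<Sum>k=1..Suc K. g (cf_a x k) (cf_a x (k+1))) = g (cf_a x 1) (cf_a x 2) + (\<Sum>k=1..K. g (cf_a y k) (cf_a y (k+1)))"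
      for g :: "int \<Rightarrow> int \<Rightarrow> real"
    proof -
      have "(\<Sum>k=1..Suc K. g (cf_a x k) (cf_a x (k+1))) = g (cf_a x 1) (cf_a x 2) + (\<Sum>k=Suc 1..Suc K. g (cf_a x k) (cf_a x (k+1)))"
        by (subst sum.atLeast_Suc_atMost) (auto simp: numeral_2_eq_2)
      also have "(\<Sum>k=Suc 1..Suc K. g (cf_a x k) (cf_a x (k+1))) = (\<Sum>k=1..K. g (cf_a y k) (cf_a y (k+1)))"
        unfolding sum.shift_bounds_cl_Suc_ivl by (simp add: cf_a_Suc[of x] y_def)
      finally show ?thesis .
    qed
    define E where "E = ln (sinprod (Nstar x (Suc K)) \<alpha>) - ln (sinprod (Nstar y K) y) - V * y - ln y / 2"
    have "\<bar>E\<bar> \<le> C * \<alpha>"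
      using C(2)[OF \<alpha>, of "Nstar x (Suc K)" "Nstar y K"] Nstar_renormalization_bounds[OF Suc.prems, of K]
      by (simp add: E_def \<alpha>_def y_def V_def)
    also have "\<dots> \<le> C * (1 / a)" using C(1) \<alpha>a by (intro mult_left_mono)
    finally have E: "\<bar>E\<bar> \<le> C * (1 / a)" .
    define G where "G = V * frac y"
    have G: "\<bar>G\<bar> \<le> \<bar>V\<bar> * (1 / a')"
      unfolding G_def abs_mult using fy by (intro mult_left_mono) auto
    \<comment> \<open>E is the renormalization error, while G and R are the errors of replacing y by
      a in the volume term and in the logarithm.\<close>
    define R where "R = ln y - ln a"
    have R: "0 \<le> R" "R \<le> 1 / a'"
    proof -
      show "0 \<le> R" using ay by (simp add: R_def)
      have "R \<le> (y - a) / a" unfolding R_def using ay by (intro ln_diff_le) auto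
      also have "y - a = frac y" using y_eq by linarith
      also have "frac y / a \<le> frac y / 1" using a1 by (intro divide_left_mono) auto
      finally show "R \<le> 1 / a'" using fy by simp
    qed
    have "S x (Suc K) = S y K + E + G + R / 2"
    proof -
      have "V * y = V * a + G" unfolding G_def by (subst y_eq) (simp add: distrib_left)
      then show ?thesis
        using shift[of "\<lambda>u v. real_of_int u"] shift[of "\<lambda>u v. ln (real_of_int u)"]
        by (simp add: S_def E_def R_def \<alpha>_def sinprod_frac a_def algebra_simps add_divide_distrib diff_divide_distrib)
    qed
    then have "\<bar>S x (Suc K)\<bar> \<le> \<bar>S y K\<bar> + C * (1 / a) + \<bar>V\<bar> * (1 / a') + 1 / a'"
      using E G R by linarith
    also have "\<dots> \<le> \<bar>S y K\<bar> + D * (1 / a + 1 / a')"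
    proof -
      have "C * (1 / a) \<le> D * (1 / a)" unfolding D_def using a1 by (intro mult_right_mono) auto
      moreover have "(\<bar>V\<bar> + 1) * (1 / a') \<le> D * (1 / a')"
        unfolding D_def using a1 C(1) by (intro mult_right_mono) auto
      moreover have "(\<bar>V\<bar> + 1) * (1 / a') = \<bar>V\<bar> * (1 / a') + 1 / a'" by (simp add: add_divide_distrib)
      ultimately show ?thesis unfolding distrib_left by linarith
    qed
    also have "\<dots> \<le> D * (\<Sum>k=1..K. 1 / real_of_int (cf_a y k) + 1 / real_of_int (cf_a y (k+1))) + D * (1 / a + 1 / a')"
      using Suc.IH[OF y] by simp
    also have "\<dots> = D * (\<Sum>k=1..Suc K. 1 / real_of_int (cf_a x k) + 1 / real_of_int (cf_a x (k+1)))"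
      unfolding shift[of "\<lambda>u v. 1 / real_of_int u + 1 / real_of_int v"]
      by (simp add: a_def a'_def distrib_left)
    finally show ?case .
  qed
  then show ?thesis using D unfolding S_def V_def by blast
qed

theorem theorem3:
  fixes T :: real
  assumes "T \<ge> 1"
  shows "\<exists>C. \<forall>\<alpha>::real. \<forall>k0::nat.
    \<alpha> \<notin> \<rat> \<longrightarrow> k0 \<ge> 1 \<longrightarrow>
    (\<forall>k\<ge>k0. ln (real_of_int (cf_a \<alpha> k)) / real_of_int (cf_a \<alpha> (k+1)) \<le> T) \<longrightarrow>
    (\<exists>C\<alpha>. \<forall>K::nat.
       \<bar>ln (sinprod (Nstar \<alpha> K) \<alpha>)
         - vol41 / (4 * pi) * (\<Sum>k=1..K. real_of_int (cf_a \<alpha> k))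
         - 1/2 * (\<Sum>k=1..K. ln (real_of_int (cf_a \<alpha> k)))\<bar>
       \<le> C * (\<Sum>k=1..K. (1 + ln (real_of_int (cf_a \<alpha> k * cf_a \<alpha> (k+1))))
                           / real_of_int (cf_a \<alpha> (k+1)))
         + C\<alpha>)"
proof -
  obtain D where D: "D \<ge> 0" "\<And>x K. x \<notin> \<rat> \<Longrightarrow>
     \<bar>ln (sinprod (Nstar x K) x) - vol41 / (4 * pi) * (\<Sum>k=1..K. real_of_int (cf_a x k))
        - 1/2 * (\<Sum>k=1..K. ln (real_of_int (cf_a x k)))\<bar>
     \<le> D * (\<Sum>k=1..K. 1 / real_of_int (cf_a x k) + 1 / real_of_int (cf_a x (k+1)))"
    using sinprod_Nstar_asymptotics by blast
  have sum_bound: "(\<Sum>k=1..K. 1 / real_of_int (cf_a \<alpha> k) + 1 / real_of_int (cf_a \<alpha> (k+1)))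
      \<le> 2 * (\<Sum>k=1..K. (1 + ln (real_of_int (cf_a \<alpha> k * cf_a \<alpha> (k+1)))) / real_of_int (cf_a \<alpha> (k+1))) + 1"
    if \<alpha>: "\<alpha> \<notin> \<rat>" for \<alpha> K
  proof -
    have a: "real_of_int (cf_a \<alpha> k) \<ge> 1" if "k \<ge> 1" for k
      using cf_a_Suc_pos[OF \<alpha>, of "k - 1"] that by simp
    have 1: "(\<Sum>k=1..K. 1 / real_of_int (cf_a \<alpha> (k+1)))
        \<le> (\<Sum>k=1..K. (1 + ln (real_of_int (cf_a \<alpha> k * cf_a \<alpha> (k+1)))) / real_of_int (cf_a \<alpha> (k+1)))"
    proof (rule sum_mono)
      fix k assume "k \<in> {1..K}"
      then have k: "real_of_int (cf_a \<alpha> k) \<ge> 1" "real_of_int (cf_a \<alpha> (k+1)) \<ge> 1" using a by auto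
      then have "1 * 1 \<le> real_of_int (cf_a \<alpha> k) * real_of_int (cf_a \<alpha> (k+1))" by (intro mult_mono) auto
      then have "0 \<le> ln (real_of_int (cf_a \<alpha> k * cf_a \<alpha> (k+1)))" by (intro ln_ge_zero) simp
      then show "1 / real_of_int (cf_a \<alpha> (k+1))
          \<le> (1 + ln (real_of_int (cf_a \<alpha> k * cf_a \<alpha> (k+1)))) / real_of_int (cf_a \<alpha> (k+1))"
        using k by (intro divide_right_mono) auto
    qed
    \<comment> \<open>An index shift by one: only the boundary term 1 / a_1 \<le> 1 is lost, and it
      ends up in the additive constant.\<close>
    have 2: "(\<Sum>k=1..K. 1 / real_of_int (cf_a \<alpha> k)) \<le> (\<Sum>k=1..K. 1 / real_of_int (cf_a \<alpha> (k+1))) + 1"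
    proof -
      have "(\<Sum>k=1..K. 1 / real_of_int (cf_a \<alpha> k)) + 1 / real_of_int (cf_a \<alpha> (K+1))
          = 1 / real_of_int (cf_a \<alpha> 1) + (\<Sum>k=1..K. 1 / real_of_int (cf_a \<alpha> (k+1)))"
        by (induction K) auto
      moreover have "1 / real_of_int (cf_a \<alpha> 1) \<le> 1" "1 / real_of_int (cf_a \<alpha> (K+1)) \<ge> 0"
        using a[of 1] a[of "K + 1"] by simp_all
      ultimately show ?thesis by linarith
    qed
    show ?thesis using 1 2 by (simp add: sum.distrib)
  qed
  show ?thesis
  proof (rule exI[of _ "2 * D"], intro allI impI, rule exI[of _ D], rule allI)
    fix \<alpha> :: real and k0 K :: nat
    assume \<alpha>: "\<alpha> \<notin> \<rat>"
    note D(2)[OF \<alpha>, of K]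
    also have "D * (\<Sum>k=1..K. 1 / real_of_int (cf_a \<alpha> k) + 1 / real_of_int (cf_a \<alpha> (k+1)))
      \<le> D * (2 * (\<Sum>k=1..K. (1 + ln (real_of_int (cf_a \<alpha> k * cf_a \<alpha> (k+1)))) / real_of_int (cf_a \<alpha> (k+1))) + 1)"
      using D(1) sum_bound[OF \<alpha>] by (intro mult_left_mono)
    finally show "\<bar>ln (sinprod (Nstar \<alpha> K) \<alpha>)
         - vol41 / (4 * pi) * (\<Sum>k=1..K. real_of_int (cf_a \<alpha> k))
         - 1/2 * (\<Sum>k=1..K. ln (real_of_int (cf_a \<alpha> k)))\<bar>
       \<le> 2 * D * (\<Sum>k=1..K. (1 + ln (real_of_int (cf_a \<alpha> k * cf_a \<alpha> (k+1))))
                           / real_of_int (cf_a \<alpha> (k+1))) + D"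
      by (simp add: distrib_left)
  qed
qed

end
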